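(* Let $\mathfrak M=\{M^\lambda:\lambda\in\Lambda\}$ be a weight matrix satisfying $(\mathfrak M_{\{dc\}})$ and $(\mathfrak M_{\{C^\omega\}})$. Then the following are equivalent: (1) $\mathcal E^{\{\mathfrak M\}}$ is stable under composition. (2) $\mathcal E^{\{\mathfrak M\}}$ is holomorphically closed. (3) For all $\lambda\in\Lambda$ there are $\mu\in\Lambda$ and $C>0$ such that $(M^\lambda_j)^{1/j}\le C(M^\mu_k)^{1/k}$ for all $1\le j\le k$. (4) $\mathfrak M$ satisfies $(\mathfrak M_{\{FdB\}})$. Moreover, $(\mathfrak M_{\{C^\omega\}})$ is only needed for (1)$\Rightarrow$(2), and $(\mathfrak M_{\{dc\}})$ is only needed for (3)$\Rightarrow$(4).
   Context: A weight matrix is a family $\mathfrak M=\{M^\lambda=(M^\lambda_k)_k\in\mathbb R_{>0}^{\mathbb N}:\lambda\in\Lambda\}$, $\Lambda$ an ordered subset of $\mathbb R$, such that each $(k!M^\lambda_k)_k$ is log-convex, $M^\lambda_0=1$, $(k!M^\lambda_k)^{1/k}\to\infty$, and $M^\lambda\le M^\mu$ termwise for $\lambda\le\mu$. For $M\in\mathbb R_{>0}^{\mathbb N}$, open $U\subseteq\mathbb R^n$, compact $K$, $\rho>0$: $\|f\|^M_{K,\rho}:=\sup\{\|f^{(k)}(x)\|/(k!\rho^kM_k):x\in K,k\in\mathbb N\}$; $\mathcal E^{\{M\}}(K,\mathbb R^m)$ = smooth maps on $K$ with $\|f\|^M_{K,\rho}<\infty$ for some $\rho$. $\mathcal E^{\{\mathfrak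 M\}}(U,\mathbb R^m):=\bigcap_{K\subseteq U\text{ compact}}\bigcup_\lambda\mathcal E^{\{M^\lambda\}}(K,\mathbb R^m)$ (functions on $U$ whose restriction to each compact $K$ lies in the union), $\mathcal E^{\{\mathfrak M\}}(U,V)$ those with values in open $V$. Conditions: $(\mathfrak M_{\{dc\}})$: $\forall\lambda\exists\mu\exists C\forall k: M^\lambda_{k+1}\le C^kM^\mu_k$. $(\mathfrak M_{\{C^\omega\}})$: $\exists\lambda:\liminf_k(M^\lambda_k)^{1/k}>0$. $(\mathfrak M_{\{FdB\}})$: $\forall\lambda\exists\mu:(M^\lambda)^\circ\preceq M^\mu$, where $M^\circ_k:=\max\{M_jM_{\alpha_1}\cdots M_{\alpha_j}:\alpha_i\in\mathbb N_{>0},\alpha_1+\dots+\alpha_j=k\}$, $M^\circ_0:=1$, and $M\preceq N$ means $\exists C,\rho>0\ \forall k: M_k\le C\rho^kN_k$. A class $\mathcal F$ is stable under composition if $g\in\mathcal F(U,V),f\in\mathcal F(V,W)\Rightarrow f\circ g\in\mathcal F(U,W)$ for all open $U\subseteq\mathbb R^p,V\subseteq\mathbb R^q,W\subseteq\mathbb R^r$; holomorphically closed if $f\circ g\in\mathcal F(U,\mathbb C)$ for each $g\in\mathcal F(U,\mathbb R)$ and each $f$ holomorphic near the range of $g$. *)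

theory Defs
  imports "HOL-Analysis.Analysis"
begin

definition weight_matrix :: "real set \<Rightarrow> (real \<Rightarrow> nat \<Rightarrow> real) \<Rightarrow> bool" where
  "weight_matrix Lam M \<longleftrightarrow>
     (\<forall>l\<in>Lam. (\<forall>k. 0 < M l k) \<and> M l 0 = 1
        \<and> (\<forall>k\<ge>1. (fact k * M l k)^2 \<le> (fact (k-1) * M l (k-1)) * (fact (k+1) * M l (k+1)))
        \<and> filterlim (\<lambda>k. root k (fact k * M l k)) at_top sequentially)
   \<and> (\<forall>l\<in>Lam. \<forall>m\<in>Lam. l \<le> m \<longrightarrow> (\<forall>k. M l k \<le> M m k))"

definition cond_dc :: "real set \<Rightarrow> (real \<Rightarrow> nat \<Rightarrow> real) \<Rightarrow> bool" where
  "cond_dc Lam M \<longleftrightarrow> (\<forall>l\<in>Lam. \<exists>m\<in>Lam. \<exists>C. \<forall>k. M l (k+1) \<le> C^k * M m k)"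

definition cond_Comega :: "real set \<Rightarrow> (real \<Rightarrow> nat \<Rightarrow> real) \<Rightarrow> bool" where
  "cond_Comega Lam M \<longleftrightarrow> (\<exists>l\<in>Lam. 0 < liminf (\<lambda>k. ereal (root k (M l k))))"

definition compositions :: "nat \<Rightarrow> nat list set" where
  "compositions k = {as. (\<forall>a\<in>set as. 0 < a) \<and> sum_list as = k}"

definition circ_seq :: "(nat \<Rightarrow> real) \<Rightarrow> nat \<Rightarrow> real" where
  "circ_seq M k = (if k = 0 then 1 else
      Max ((\<lambda>as. M (length as) * prod_list (map M as)) ` compositions k))"

definition seq_preceq :: "(nat \<Rightarrow> real) \<Rightarrow> (nat \<Rightarrow> real) \<Rightarrow> bool" where
  "seq_preceq M N \<longleftrightarrow> (\<exists>C>0. \<exists>\<rho>>0. \<forall>k. M k \<le> C * \<rho>^k * N k)"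

definition cond_FdB :: "real set \<Rightarrow> (real \<Rightarrow> nat \<Rightarrow> real) \<Rightarrow> bool" where
  "cond_FdB Lam M \<longleftrightarrow> (\<forall>l\<in>Lam. \<exists>m\<in>Lam. seq_preceq (circ_seq (M l)) (M m))"

text \<open>R^n is modelled as the functions nat => real vanishing at indices >= n,
  with the (product = Euclidean) subspace topology.\<close>

definition Rn :: "nat \<Rightarrow> (nat \<Rightarrow> real) set" where
  "Rn n = {x. \<forall>i\<ge>n. x i = 0}"

definition open_Rn :: "nat \<Rightarrow> (nat \<Rightarrow> real) set \<Rightarrow> bool" where
  "open_Rn n U \<longleftrightarrow> openin (top_of_set (Rn n)) U"

definition enorm_n :: "nat \<Rightarrow> (nat \<Rightarrow> real) \<Rightarrow> real" where
  "enorm_n n x = sqrt (\<Sum>i<n. (x i)^2)"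

definition pd :: "nat \<Rightarrow> ((nat \<Rightarrow> real) \<Rightarrow> real) \<Rightarrow> (nat \<Rightarrow> real) \<Rightarrow> real" where
  "pd i f x = deriv (\<lambda>t. f (x(i := x i + t))) 0"

fun pds :: "nat list \<Rightarrow> ((nat \<Rightarrow> real) \<Rightarrow> real) \<Rightarrow> (nat \<Rightarrow> real) \<Rightarrow> real" where
  "pds [] f = f"
| "pds (i # is) f = pd i (pds is f)"

definition smooth_scalar :: "nat \<Rightarrow> (nat \<Rightarrow> real) set \<Rightarrow> ((nat \<Rightarrow> real) \<Rightarrow> real) \<Rightarrow> bool" where
  "smooth_scalar p U f \<longleftrightarrow>
     (\<forall>is. set is \<subseteq> {..<p} \<longrightarrow>
        continuous_on U (pds is f) \<and>
        (\<forall>i<p. \<forall>x\<in>U. (\<lambda>t. pds is f (x(i := x i + t))) differentiable (at 0)))"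

definition smooth_map :: "nat \<Rightarrow> nat \<Rightarrow> (nat \<Rightarrow> real) set \<Rightarrow> ((nat \<Rightarrow> real) \<Rightarrow> (nat \<Rightarrow> real)) \<Rightarrow> bool" where
  "smooth_map p m U f \<longleftrightarrow> (\<forall>x\<in>U. f x \<in> Rn m) \<and> (\<forall>j<m. smooth_scalar p U (\<lambda>x. f x j))"

definition Dk :: "nat \<Rightarrow> ((nat \<Rightarrow> real) \<Rightarrow> (nat \<Rightarrow> real)) \<Rightarrow> nat \<Rightarrow> (nat \<Rightarrow> real)
                   \<Rightarrow> (nat \<Rightarrow> real) list \<Rightarrow> nat \<Rightarrow> real" where
  "Dk p f k x hs j = (\<Sum>is\<in>{is. length is = k \<and> set is \<subseteq> {..<p}}.
        pds is (\<lambda>y. f y j) x * (\<Prod>l<k. (hs ! l) (is ! l)))"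

definition dnorm :: "nat \<Rightarrow> nat \<Rightarrow> ((nat \<Rightarrow> real) \<Rightarrow> (nat \<Rightarrow> real)) \<Rightarrow> nat \<Rightarrow> (nat \<Rightarrow> real) \<Rightarrow> real" where
  "dnorm p m f k x = (SUP hs\<in>{hs. length hs = k \<and> (\<forall>h\<in>set hs. h \<in> Rn p \<and> enorm_n p h \<le> 1)}.
        enorm_n m (Dk p f k x hs))"

definition in_EM :: "nat \<Rightarrow> nat \<Rightarrow> (nat \<Rightarrow> real) \<Rightarrow> (nat \<Rightarrow> real) set
                     \<Rightarrow> ((nat \<Rightarrow> real) \<Rightarrow> (nat \<Rightarrow> real)) \<Rightarrow> bool" where
  "in_EM p m M K f \<longleftrightarrow>
     (\<exists>\<rho>>0. \<exists>B. \<forall>x\<in>K. \<forall>k. dnorm p m f k x \<le> B * (fact k * \<rho>^k * M k))"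

definition EMat :: "real set \<Rightarrow> (real \<Rightarrow> nat \<Rightarrow> real) \<Rightarrow> nat \<Rightarrow> nat \<Rightarrow> (nat \<Rightarrow> real) set
                    \<Rightarrow> ((nat \<Rightarrow> real) \<Rightarrow> (nat \<Rightarrow> real)) set" where
  "EMat Lam M p m U = {f. smooth_map p m U f \<and>
      (\<forall>K. compact K \<and> K \<subseteq> U \<longrightarrow> (\<exists>l\<in>Lam. in_EM p m (M l) K f))}"

definition EMat_to :: "real set \<Rightarrow> (real \<Rightarrow> nat \<Rightarrow> real) \<Rightarrow> nat \<Rightarrow> nat \<Rightarrow> (nat \<Rightarrow> real) set
                    \<Rightarrow> (nat \<Rightarrow> real) set \<Rightarrow> ((nat \<Rightarrow> real) \<Rightarrow> (nat \<Rightarrow> real)) set" where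
  "EMat_to Lam M p q U V = {f \<in> EMat Lam M p q U. f ` U \<subseteq> V}"

definition stable_comp :: "real set \<Rightarrow> (real \<Rightarrow> nat \<Rightarrow> real) \<Rightarrow> bool" where
  "stable_comp Lam M \<longleftrightarrow>
     (\<forall>p q r U V W g f. open_Rn p U \<and> open_Rn q V \<and> open_Rn r W \<and>
        g \<in> EMat_to Lam M p q U V \<and> f \<in> EMat_to Lam M q r V W \<longrightarrow>
        f \<circ> g \<in> EMat_to Lam M p r U W)"

text \<open>C is identified with R^2 via z |-> (Re z, Im z); R-valued maps are R^1-valued maps.\<close>
definition c2v :: "complex \<Rightarrow> nat \<Rightarrow> real" where
  "c2v z = (\<lambda>j. if j = 0 then Re z else if j = 1 then Im z else 0)"

definition holo_closed :: "real set \<Rightarrow> (real \<Rightarrow> nat \<Rightarrow> real) \<Rightarrow> bool" where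
  "holo_closed Lam M \<longleftrightarrow>
     (\<forall>p U g F Om. open_Rn p U \<and> g \<in> EMat Lam M p 1 U \<and>
        open Om \<and> (\<lambda>x. complex_of_real (g x 0)) ` U \<subseteq> Om \<and> F holomorphic_on Om \<longrightarrow>
        (\<lambda>x. c2v (F (complex_of_real (g x 0)))) \<in> EMat Lam M p 2 U)"

definition cond_root :: "real set \<Rightarrow> (real \<Rightarrow> nat \<Rightarrow> real) \<Rightarrow> bool" where
  "cond_root Lam M \<longleftrightarrow> (\<forall>l\<in>Lam. \<exists>m\<in>Lam. \<exists>C>0. \<forall>j k. 1 \<le> j \<and> j \<le> k \<longrightarrow>
       root j (M l j) \<le> C * root k (M m k))"

end

theory Submission
  imports Defs "HOL-Complex_Analysis.Complex_Analysis"
begin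

text \<open>
  Partial derivatives of a map at a point are dominated by the coefficients of a formal power series.
  Such majorants multiply, and compose by the chain rule, so the Faa di Bruno estimate for
  \<^term>\<open>f \<circ> g\<close> becomes a coefficient estimate for a composition of power series, whose coefficients
  are exactly the products bounded by \<^const>\<open>circ_seq\<close>.

  Composition with a holomorphic function is composition with a real analytic one, which by the Cauchy
  inequalities lies in the class as soon as some weight dominates a geometric sequence.

  Conversely, let N k = k! M k with quotients q k = N (k+1) / N k. The function
  g x = \<Sum>k. 2^(-k-1) N k (q k)^(-k) cos (q k x) lies in the class and its even derivatives at 0 have
  alternating signs and essentially maximal size. If 1 / (1 + g 0 - g) is in the class, then all terms of
  its Taylor coefficients have the same sign, and comparing the coefficient of order 2in with the n-th
  power of the one of g of order 2i gives the root condition along multiples of even indices.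
  Monotonicity of the k-th roots of N k fills the gaps.

  From the root condition to the Faa di Bruno condition, the derivation-closedness replaces each factor
  M a of a composition by M (a - 1), which compensates the extra factor M (length as).
\<close>

text \<open>Everything is phrased with iterated partial derivatives along index lists and no total
  derivative is formed. The price is a chain rule derived from continuous partial derivatives, and
  smoothness counted order by order so that product and chain rules can be iterated by induction.

  The necessity of the root condition has to produce one weight for all pairs j \<le> k. So one test
  function g must be nearly extremal at all even orders simultaneously, and the holomorphic function
  applied to it must exclude cancellation. The factor (q k)^(-k) comes from the supporting line of
  the convex sequence log N at k: before weighting, term k has k-th derivatives of size N k and
  stays below N j at every other order j. The weights 2^(-k-1) sum to 1, so the whole series stays
  below N j. Cosines keep g real valued, at the cost that only even orders are visible at 0. They
  all peak at 0, so 1 + g 0 - g is at least 1 and z |-> 1 / (1 + g 0 - z) is holomorphic near the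
  range of g.\<close>

unbundle no vec_syntax

subsection \<open>Partial derivatives on open subsets of coordinate space\<close>

lemma tendsto_fun_coordinatewise:
  fixes f :: "'a \<Rightarrow> 'b \<Rightarrow> 'c::topological_space"
  assumes "\<And>i. ((\<lambda>t. f t i) \<longlongrightarrow> l i) F"
  shows "(f \<longlongrightarrow> l) F"
proof -
  have "limitin (product_topology (\<lambda>i::'b. euclidean :: 'c topology) UNIV) f l F"
    using assms by (simp add: limitin_componentwise)
  then show ?thesis
    by (simp add: euclidean_product_topology)
qed

lemma open_Rn_subset: "open_Rn n U \<Longrightarrow> x \<in> U \<Longrightarrow> x \<in> Rn n"
  using openin_imp_subset unfolding open_Rn_def by blast

text \<open>Counterexamples in boxes of side 1/(n+1) would converge to y in the first q coordinates.
  All other coordinates vanish on \<open>Rn q\<close>, so this is already convergence in the product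
  topology, contradicting openness.\<close>

lemma open_Rn_box:
  assumes "open_Rn q V" "y \<in> V"
  obtains e where "e > 0" "\<And>z. z \<in> Rn q \<Longrightarrow> (\<And>i. i < q \<Longrightarrow> \<bar>z i - y i\<bar> < e) \<Longrightarrow> z \<in> V"
proof -
  obtain T where T: "open T" "V = Rn q \<inter> T"
    using assms(1) unfolding open_Rn_def openin_open by blast
  have "\<exists>e>0. \<forall>z\<in>Rn q. (\<forall>i<q. \<bar>z i - y i\<bar> < e) \<longrightarrow> z \<in> V"
  proof (rule ccontr)
    assume *: "\<not> ?thesis"
    have "\<exists>z\<in>Rn q. (\<forall>i<q. \<bar>z i - y i\<bar> < inverse (real (Suc n))) \<and> z \<notin> V" for n
    proof -
      have "inverse (real (Suc n)) > 0"
        by simp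
      with * show ?thesis
        by blast
    qed
    then obtain z where z: "\<And>n. z n \<in> Rn q" "\<And>n i. i < q \<Longrightarrow> \<bar>z n i - y i\<bar> < inverse (real (Suc n))"
      "\<And>n. z n \<notin> V"
      by metis
    have "(\<lambda>n. z n i) \<longlonglongrightarrow> y i" for i
    proof (cases "i < q")
      case True
      have "(\<lambda>n. z n i - y i) \<longlonglongrightarrow> 0"
        by (rule tendsto_rabs_zero_cancel, rule tendsto_sandwich[OF _ _ tendsto_const LIMSEQ_inverse_real_of_nat])
          (use z(2)[OF True] in \<open>auto intro!: always_eventually less_imp_le\<close>)
      then show ?thesis
        by (simp add: LIM_zero_cancel)
    next
      case False
      moreover have "y \<in> Rn q"
        using assms open_Rn_subset by blast
      ultimately show ?thesis
        using z(1) by (simp add: Rn_def)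
    qed
    then have "z \<longlonglongrightarrow> y"
      by (rule tendsto_fun_coordinatewise)
    moreover have "y \<in> T"
      using assms(2) T by blast
    ultimately have "eventually (\<lambda>n. z n \<in> T) sequentially"
      using T(1) topological_tendstoD by blast
    then obtain n where "z n \<in> T"
      by (meson eventually_sequentially order_refl)
    with z T(2) show False
      by blast
  qed
  then show ?thesis
    using that by blast
qed

lemma open_Rn_coordinate_line:
  assumes "open_Rn p U" "x \<in> U" "i < p"
  shows "\<forall>\<^sub>F t in nhds 0. x(i := x i + t) \<in> U"
proof -
  obtain e where e: "e > 0" "\<And>z. z \<in> Rn p \<Longrightarrow> (\<And>i. i < p \<Longrightarrow> \<bar>z i - x i\<bar> < e) \<Longrightarrow> z \<in> U"
    using open_Rn_box[OF assms(1,2)] by blast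
  have "x(i := x i + t) \<in> U" if "\<bar>t\<bar> < e" for t
    using that assms open_Rn_subset[OF assms(1,2)] \<open>e > 0\<close> by (intro e(2)) (auto simp: Rn_def)
  then show ?thesis
    unfolding eventually_nhds_metric using e(1) by (auto simp: dist_real_def)
qed

lemma pd_eqI:
  "((\<lambda>t. f (x(i := x i + t))) has_real_derivative D) (at 0) \<Longrightarrow> pd i f x = D"
  unfolding pd_def by (rule DERIV_imp_deriv)

lemma has_real_derivative_pd:
  "(\<lambda>t. f (x(i := x i + t))) differentiable (at 0) \<Longrightarrow>
   ((\<lambda>t. f (x(i := x i + t))) has_real_derivative pd i f x) (at (0::real))"
  unfolding pd_def by (simp add: DERIV_deriv_iff_real_differentiable)

text \<open>The unordered form is used because, in the chain rule, the increment of a coordinate may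
  have either sign or vanish.\<close>

lemma MVT_closed_segment:
  fixes f :: "real \<Rightarrow> real"
  assumes "\<And>x. x \<in> closed_segment a b \<Longrightarrow> (f has_real_derivative f' x) (at x)"
  shows "\<exists>z\<in>closed_segment a b. f b - f a = (b - a) * f' z"
proof -
  consider "a = b" | "a < b" | "b < a"
    by linarith
  then show ?thesis
  proof cases
    case 1
    then show ?thesis
      by simp
  next
    case 2
    then obtain z where "a < z" "z < b" "f b - f a = (b - a) * f' z"
      using MVT2[of a b f f'] assms by (auto simp: closed_segment_eq_real_ivl)
    then show ?thesis
      using 2 by (auto simp: closed_segment_eq_real_ivl)
  next
    case 3
    then obtain z where "b < z" "z < a" "f a - f b = (a - b) * f' z"
      using MVT2[of b a f f'] assms by (auto simp: closed_segment_eq_real_ivl)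
    then show ?thesis
      using 3 by (intro bexI[of _ z]) (auto simp: closed_segment_eq_real_ivl algebra_simps)
  qed
qed

text \<open>The increment of h is telescoped by moving one coordinate at a time. Each move is
  handled by the mean value theorem, and the intermediate points tend to \<open>y 0\<close>, where
  the partial derivatives of h are continuous.\<close>

lemma chain_rule_pd:
  fixes y :: "real \<Rightarrow> nat \<Rightarrow> real"
  assumes V: "open_Rn q V"
    and diff: "\<And>a v. a < q \<Longrightarrow> v \<in> V \<Longrightarrow> (\<lambda>t. h (v(a := v a + t))) differentiable (at 0)"
    and cont: "\<And>a. a < q \<Longrightarrow> continuous_on V (pd a h)"
    and y: "\<And>a. a < q \<Longrightarrow> ((\<lambda>t. y t a) has_real_derivative d a) (at 0)"
    and yV: "\<forall>\<^sub>F t in nhds 0. y t \<in> V"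
  shows "((\<lambda>t. h (y t)) has_real_derivative (\<Sum>a<q. pd a h (y 0) * d a)) (at 0)"
proof -
  have y0: "y 0 \<in> V"
    using yV eventually_nhds_x_imp_x by blast
  have y0R: "y 0 \<in> Rn q"
    using open_Rn_subset[OF V y0] .
  obtain e where e: "e > 0" "\<And>z. z \<in> Rn q \<Longrightarrow> (\<And>i. i < q \<Longrightarrow> \<bar>z i - y 0 i\<bar> < e) \<Longrightarrow> z \<in> V"
    using open_Rn_box[OF V y0] by blast
  have ylim: "((\<lambda>t. y t a) \<longlongrightarrow> y 0 a) (at 0)" if "a < q" for a
    using DERIV_isCont[OF y[OF that]] by (simp add: isCont_def)
  have near: "\<forall>\<^sub>F t in at 0. \<forall>a<q. \<bar>y t a - y 0 a\<bar> < e"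
  proof -
    have "\<forall>a\<in>{..<q}. \<forall>\<^sub>F t in at 0. \<bar>y t a - y 0 a\<bar> < e"
      using tendstoD[OF ylim e(1)] by (simp add: dist_real_def)
    then have "\<forall>\<^sub>F t in at 0. \<forall>a\<in>{..<q}. \<bar>y t a - y 0 a\<bar> < e"
      by (simp add: eventually_ball_finite)
    then show ?thesis
      by (simp add: Ball_def)
  qed
  \<comment> \<open>The first b coordinates have already moved. Thus \<open>z 0 t\<close> is
    \<open>y 0\<close>, and \<open>z q t\<close> is \<open>y t\<close> because coordinates from q on
    vanish in both.\<close>
  define z where "z b t = (\<lambda>i. if i < b then y t i else y 0 i)" for b t
  have step: "((\<lambda>t. (h (z (Suc b) t) - h (z b t)) / t) \<longlongrightarrow> pd b h (y 0) * d b) (at 0)" if b: "b < q" for b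
  proof -
    have zV: "(z b t)(b := s) \<in> V" if "\<forall>a<q. \<bar>y t a - y 0 a\<bar> < e" "s \<in> closed_segment (y 0 b) (y t b)" for t s
    proof (rule e(2))
      show "(z b t)(b := s) \<in> Rn q"
        using y0R b by (auto simp: z_def Rn_def)
      have "\<bar>s - y 0 b\<bar> < e"
        using that(1) that(2) b by (smt (verit) closed_segment_eq_real_ivl atLeastAtMost_iff)
      then show "\<bar>((z b t)(b := s)) i - y 0 i\<bar> < e" if "i < q" for i
        using \<open>\<forall>a<q. \<bar>y t a - y 0 a\<bar> < e\<close> that e(1) by (auto simp: z_def)
    qed
    \<comment> \<open>The smallness condition sits under the existential quantifier so that a choice
      function \<open>\<xi>\<close> defined for every t can be extracted.\<close>
    have "\<exists>s. (\<forall>a<q. \<bar>y t a - y 0 a\<bar> < e) \<longrightarrow> s \<in> closed_segment (y 0 b) (y t b) \<and>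
        h (z (Suc b) t) - h (z b t) = (y t b - y 0 b) * pd b h ((z b t)(b := s))" for t
    proof (cases "\<forall>a<q. \<bar>y t a - y 0 a\<bar> < e")
      case True
      have "((\<lambda>s. h ((z b t)(b := s))) has_real_derivative pd b h ((z b t)(b := s))) (at s)"
        if "s \<in> closed_segment (y 0 b) (y t b)" for s
      proof -
        have "((\<lambda>u. h (((z b t)(b := s))(b := ((z b t)(b := s)) b + u))) has_real_derivative
            pd b h ((z b t)(b := s))) (at 0)"
          by (rule has_real_derivative_pd, rule diff[OF b zV[OF True that]])
        then have "((\<lambda>u. h ((z b t)(b := s + u))) has_real_derivative pd b h ((z b t)(b := s))) (at 0)"
          by simp
        then show ?thesis
          using DERIV_shift[of "\<lambda>s. h ((z b t)(b := s))" "pd b h ((z b t)(b := s))" 0 s]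
          by (simp add: add.commute)
      qed
      from MVT_closed_segment[OF this] obtain s where "s \<in> closed_segment (y 0 b) (y t b)"
        "h ((z b t)(b := y t b)) - h ((z b t)(b := y 0 b)) = (y t b - y 0 b) * pd b h ((z b t)(b := s))"
        by blast
      moreover have "(z b t)(b := y t b) = z (Suc b) t" "(z b t)(b := y 0 b) = z b t"
        by (auto simp: z_def fun_eq_iff)
      ultimately show ?thesis
        by auto
    qed auto
    then obtain \<xi> where \<xi>: "\<And>t. (\<forall>a<q. \<bar>y t a - y 0 a\<bar> < e) \<Longrightarrow> \<xi> t \<in> closed_segment (y 0 b) (y t b)"
      "\<And>t. (\<forall>a<q. \<bar>y t a - y 0 a\<bar> < e) \<Longrightarrow>
        h (z (Suc b) t) - h (z b t) = (y t b - y 0 b) * pd b h ((z b t)(b := \<xi> t))"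
      by metis
    have \<xi>lim: "(\<xi> \<longlongrightarrow> y 0 b) (at 0)"
    proof (rule tendsto_sandwich)
      show "\<forall>\<^sub>F t in at 0. min (y 0 b) (y t b) \<le> \<xi> t"
        using near by eventually_elim (use \<xi>(1) in \<open>fastforce simp: closed_segment_eq_real_ivl split: if_splits\<close>)
      show "\<forall>\<^sub>F t in at 0. \<xi> t \<le> max (y 0 b) (y t b)"
        using near by eventually_elim (use \<xi>(1) in \<open>fastforce simp: closed_segment_eq_real_ivl split: if_splits\<close>)
      show "((\<lambda>t. min (y 0 b) (y t b)) \<longlongrightarrow> y 0 b) (at 0)"
        using tendsto_min[OF tendsto_const[of "y 0 b"] ylim[OF b]] by simp
      show "((\<lambda>t. max (y 0 b) (y t b)) \<longlongrightarrow> y 0 b) (at 0)"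
        using tendsto_max[OF tendsto_const[of "y 0 b"] ylim[OF b]] by simp
    qed
    have "((\<lambda>t. (z b t)(b := \<xi> t)) \<longlongrightarrow> y 0) (at 0)"
    proof (rule tendsto_fun_coordinatewise)
      show "((\<lambda>t. ((z b t)(b := \<xi> t)) i) \<longlongrightarrow> y 0 i) (at 0)" for i
        using \<xi>lim ylim b by (cases "i = b"; cases "i < b") (auto simp: z_def)
    qed
    moreover have "\<forall>\<^sub>F t in at 0. (z b t)(b := \<xi> t) \<in> V"
      using near by eventually_elim (use zV \<xi>(1) in blast)
    ultimately have "((\<lambda>t. pd b h ((z b t)(b := \<xi> t))) \<longlongrightarrow> pd b h (y 0)) (at 0)"
      using continuous_on_tendsto_compose[OF cont[OF b] _ y0] by blast
    moreover have "((\<lambda>t. (y t b - y 0 b) / t) \<longlongrightarrow> d b) (at 0)"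
      using y[OF b] by (simp add: DERIV_def)
    ultimately have "((\<lambda>t. pd b h ((z b t)(b := \<xi> t)) * ((y t b - y 0 b) / t)) \<longlongrightarrow> pd b h (y 0) * d b) (at 0)"
      by (rule tendsto_mult)
    then show ?thesis
      by (rule Lim_transform_eventually) (use near in eventually_elim, use \<xi>(2) in simp)
  qed
  have "((\<lambda>t. \<Sum>b<q. (h (z (Suc b) t) - h (z b t)) / t) \<longlongrightarrow> (\<Sum>a<q. pd a h (y 0) * d a)) (at 0)"
    by (intro tendsto_sum step) auto
  moreover have "\<forall>\<^sub>F t in at 0. (\<Sum>b<q. (h (z (Suc b) t) - h (z b t)) / t) = (h (y t) - h (y 0)) / t"
  proof -
    have "\<forall>\<^sub>F t in at 0. y t \<in> V"
      using yV by (auto simp: eventually_at_filter elim: eventually_mono)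
    then show ?thesis
    proof eventually_elim
      case (elim t)
      have "z q t = y t"
        using open_Rn_subset[OF V elim] y0R by (auto simp: z_def Rn_def fun_eq_iff)
      moreover have "z 0 t = y 0"
        by (simp add: z_def)
      ultimately show ?case
        using sum_lessThan_telescope[of "\<lambda>b. h (z b t)" q]
        by (simp add: sum_divide_distrib[symmetric])
    qed
  qed
  ultimately have "((\<lambda>t. (h (y t) - h (y 0)) / t) \<longlongrightarrow> (\<Sum>a<q. pd a h (y 0) * d a)) (at 0)"
    by (rule Lim_transform_eventually)
  then show ?thesis
    by (simp add: DERIV_def)
qed

section \<open>Iterated partial derivatives and smoothness of finite order\<close>

lemma pds_append: "pds (is @ js) f = pds is (pds js f)"
  by (induction "is") auto

lemma pd_cong:
  assumes "open_Rn p U" "x \<in> U" "i < p" "\<And>x. x \<in> U \<Longrightarrow> f x = g x"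
  shows "pd i f x = pd i g x"
proof -
  have "\<forall>\<^sub>F t in nhds 0. f (x(i := x i + t)) = g (x(i := x i + t))"
    using open_Rn_coordinate_line[OF assms(1-3)] by eventually_elim (use assms(4) in blast)
  then show ?thesis
    unfolding pd_def by (rule deriv_cong_ev) simp
qed

lemma pds_cong:
  assumes "open_Rn p U" "\<And>x. x \<in> U \<Longrightarrow> f x = g x" "set is \<subseteq> {..<p}" "x \<in> U"
  shows "pds is f x = pds is g x"
  using assms(3,4)
proof (induction "is" arbitrary: x)
  case Nil
  then show ?case
    using assms(2) by simp
next
  case (Cons i "is")
  then show ?case
    by (auto intro!: pd_cong[OF assms(1)])
qed

lemma partially_differentiable_cong:
  assumes "open_Rn p U" "x \<in> U" "i < p" "\<And>x. x \<in> U \<Longrightarrow> f x = g x"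
    and "(\<lambda>t. f (x(i := x i + t))) differentiable (at (0::real))"
  shows "(\<lambda>t. g (x(i := x i + t) :: nat \<Rightarrow> real) :: real) differentiable (at 0)"
proof -
  have "\<forall>\<^sub>F t in nhds 0. f (x(i := x i + t)) = g (x(i := x i + t))"
    using open_Rn_coordinate_line[OF assms(1-3)] by eventually_elim (use assms(4) in blast)
  then have "((\<lambda>t. g (x(i := x i + t))) has_real_derivative pd i f x) (at 0)"
    by (rule iffD1[OF DERIV_cong_ev[OF refl _ refl] has_real_derivative_pd[OF assms(5)]])
  then show ?thesis
    using real_differentiable_def by blast
qed

text \<open>A finite order is something to induct on. Order n provides n + 1 derivatives, the last
  ones without continuity; this explains the bound \<open>Suc n\<close> on list lengths in
  \<open>pds_add\<close> and \<open>pds_sum\<close>.\<close>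

definition smooth_upto :: "nat \<Rightarrow> nat \<Rightarrow> (nat \<Rightarrow> real) set \<Rightarrow> ((nat \<Rightarrow> real) \<Rightarrow> real) \<Rightarrow> bool" where
  "smooth_upto n p U f \<longleftrightarrow>
     (\<forall>is. set is \<subseteq> {..<p} \<and> length is \<le> n \<longrightarrow>
        continuous_on U (pds is f) \<and>
        (\<forall>i<p. \<forall>x\<in>U. (\<lambda>t. pds is f (x(i := x i + t))) differentiable (at 0)))"

lemma smooth_scalar_iff_smooth_upto: "smooth_scalar p U f \<longleftrightarrow> (\<forall>n. smooth_upto n p U f)"
  unfolding smooth_scalar_def smooth_upto_def by blast

lemma smooth_upto_0:
  "smooth_upto 0 p U f \<longleftrightarrow> continuous_on U f \<and>
     (\<forall>i<p. \<forall>x\<in>U. (\<lambda>t. f (x(i := x i + t))) differentiable (at 0))"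
  by (simp add: smooth_upto_def)

text \<open>\<open>pds\<close> applies the last list entry first, so splitting it off turns a
  statement about f into one about \<open>pd i f\<close>. The rules for sums, products and
  compositions can then be substituted before further derivatives are taken.\<close>

lemma all_index_lists_Suc:
  "(\<forall>is. set is \<subseteq> A \<and> length is \<le> Suc n \<longrightarrow> Q is) \<longleftrightarrow>
   Q [] \<and> (\<forall>i\<in>A. \<forall>is. set is \<subseteq> A \<and> length is \<le> n \<longrightarrow> Q (is @ [i]))"
proof (intro iffI conjI allI impI ballI)
  fix js assume *: "Q [] \<and> (\<forall>i\<in>A. \<forall>is. set is \<subseteq> A \<and> length is \<le> n \<longrightarrow> Q (is @ [i]))"
    and js: "set js \<subseteq> A \<and> length js \<le> Suc n"
  show "Q js"
    using * js by (cases js rule: rev_cases) auto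
qed auto

lemma smooth_upto_Suc:
  "smooth_upto (Suc n) p U f \<longleftrightarrow> smooth_upto 0 p U f \<and> (\<forall>i<p. smooth_upto n p U (pd i f))"
  unfolding smooth_upto_0 unfolding smooth_upto_def all_index_lists_Suc
  by (simp add: pds_append Ball_def)

lemma smooth_upto_mono: "smooth_upto n p U f \<Longrightarrow> m \<le> n \<Longrightarrow> smooth_upto m p U f"
  unfolding smooth_upto_def by (meson order_trans)

lemma smooth_upto_SucD: "smooth_upto (Suc n) p U f \<Longrightarrow> smooth_upto n p U f"
  by (erule smooth_upto_mono) simp

lemma smooth_upto_cong:
  assumes "open_Rn p U" "\<And>x. x \<in> U \<Longrightarrow> f x = g x" "smooth_upto n p U f"
  shows "smooth_upto n p U g"
  unfolding smooth_upto_def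
proof (intro allI impI conjI ballI)
  fix "is" assume "is": "set is \<subseteq> {..<p} \<and> length is \<le> n"
  have eq: "pds is f x = pds is g x" if "x \<in> U" for x
    by (rule pds_cong[OF assms(1,2)]) (use "is" that in auto)
  show "continuous_on U (pds is g)"
    using assms(3) "is" continuous_on_cong[of U U "pds is f" "pds is g"] eq unfolding smooth_upto_def by auto
  show "(\<lambda>t. pds is g (x(i := x i + t))) differentiable (at 0)" if "i < p" "x \<in> U" for i x
    by (rule partially_differentiable_cong[OF assms(1) that(2,1), of "pds is f"])
      (use assms(3) "is" that eq in \<open>auto simp only: smooth_upto_def\<close>)
qed

lemma pd_deriv_smooth_upto:
  assumes "smooth_upto n p U f" "x \<in> U" "i < p"
  shows "((\<lambda>t. f (x(i := x i + t))) has_real_derivative pd i f x) (at 0)"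
  using smooth_upto_mono[OF assms(1), of 0] assms(2,3)
  by (auto simp: smooth_upto_0 intro: has_real_derivative_pd)

lemma smooth_upto_const: "smooth_upto n p U (\<lambda>x. c)"
proof (induction n arbitrary: c)
  case 0
  then show ?case by (simp add: smooth_upto_0)
next
  case (Suc n)
  have "pd i (\<lambda>x. c) = (\<lambda>x. 0)" for i
    by (rule ext, rule pd_eqI) simp
  then show ?case
    using Suc[of 0] Suc[of c] by (auto simp: smooth_upto_Suc intro: smooth_upto_mono)
qed

lemma smooth_upto_0_add:
  assumes "smooth_upto 0 p U f" "smooth_upto 0 p U g"
  shows "smooth_upto 0 p U (\<lambda>x. f x + g x)"
  using assms unfolding smooth_upto_0 by (simp add: continuous_on_add differentiable_add)

lemma pd_add:
  assumes "smooth_upto n p U f" "smooth_upto n p U g" "x \<in> U" "i < p"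
  shows "pd i (\<lambda>x. f x + g x) x = pd i f x + pd i g x"
  by (intro pd_eqI DERIV_add pd_deriv_smooth_upto[OF assms(1,3,4)] pd_deriv_smooth_upto[OF assms(2,3,4)])

lemma smooth_upto_add:
  assumes "open_Rn p U" "smooth_upto n p U f" "smooth_upto n p U g"
  shows "smooth_upto n p U (\<lambda>x. f x + g x)"
  using assms(2,3)
proof (induction n arbitrary: f g)
  case 0
  then show ?case by (rule smooth_upto_0_add)
next
  case (Suc n)
  have "smooth_upto n p U (pd i (\<lambda>x. f x + g x))" if "i < p" for i
    by (rule smooth_upto_cong[OF assms(1) pd_add[OF Suc.prems _ that, symmetric]])
      (use Suc that in \<open>auto simp: smooth_upto_Suc\<close>)
  then show ?case
    using Suc.prems smooth_upto_0_add by (auto simp: smooth_upto_Suc)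
qed

lemma pds_add:
  assumes "open_Rn p U" "smooth_upto n p U f" "smooth_upto n p U g"
    and "set is \<subseteq> {..<p}" "length is \<le> Suc n" "x \<in> U"
  shows "pds is (\<lambda>x. f x + g x) x = pds is f x + pds is g x"
  using assms(2-)
proof (induction "is" arbitrary: f g n rule: rev_induct)
  case Nil
  then show ?case by simp
next
  case (snoc i "is")
  have i: "i < p"
    using snoc.prems by simp
  have "pds is (pd i (\<lambda>x. f x + g x)) x = pds is (\<lambda>x. pd i f x + pd i g x) x"
    by (rule pds_cong[OF assms(1) pd_add[OF snoc.prems(1,2)]]) (use snoc.prems in auto)
  also have "\<dots> = pds is (pd i f) x + pds is (pd i g) x"
  proof (cases n)
    case 0
    with snoc.prems have "is = []" by simp
    then show ?thesis by simp
  next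
    case (Suc m)
    then show ?thesis
      using snoc.prems i by (intro snoc.IH[of m]) (auto simp: smooth_upto_Suc)
  qed
  finally show ?case
    by (simp add: pds_append)
qed

lemma smooth_upto_sum:
  assumes "open_Rn p U" "finite A" "\<And>a. a \<in> A \<Longrightarrow> smooth_upto n p U (f a)"
  shows "smooth_upto n p U (\<lambda>x. \<Sum>a\<in>A. f a x)"
  using assms(2,3)
proof (induction A rule: finite_induct)
  case empty
  then show ?case
    by (simp add: smooth_upto_const)
next
  case (insert a A)
  then show ?case
    by (simp add: smooth_upto_add[OF assms(1)])
qed

lemma pds_sum:
  assumes "open_Rn p U" "finite A" "\<And>a. a \<in> A \<Longrightarrow> smooth_upto n p U (f a)"
    and "set is \<subseteq> {..<p}" "length is \<le> Suc n" "x \<in> U"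
  shows "pds is (\<lambda>x. \<Sum>a\<in>A. f a x) x = (\<Sum>a\<in>A. pds is (f a) x)"
  using assms(2,3)
proof (induction A rule: finite_induct)
  case empty
  have "pd i (\<lambda>x. 0) = (\<lambda>x. 0)" for i
    by (rule ext, rule pd_eqI) simp
  then have "pds is (\<lambda>x. 0) = (\<lambda>x. 0)"
    by (induction "is") auto
  then show ?case
    by simp
next
  case (insert a A)
  then show ?case
    using pds_add[OF assms(1) _ smooth_upto_sum[OF assms(1), of A n f] assms(4-)] by simp
qed

lemma smooth_upto_0_mult:
  assumes "smooth_upto 0 p U f" "smooth_upto 0 p U g"
  shows "smooth_upto 0 p U (\<lambda>x. f x * g x)"
  using assms unfolding smooth_upto_0 by (simp add: continuous_on_mult differentiable_mult)

lemma pd_mult: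
  assumes "smooth_upto n p U f" "smooth_upto n p U g" "x \<in> U" "i < p"
  shows "pd i (\<lambda>x. f x * g x) x = pd i f x * g x + f x * pd i g x"
  using DERIV_mult[OF pd_deriv_smooth_upto[OF assms(1,3,4)] pd_deriv_smooth_upto[OF assms(2,3,4)]]
  by (intro pd_eqI) (simp add: algebra_simps)

lemma smooth_upto_mult:
  assumes "open_Rn p U" "smooth_upto n p U f" "smooth_upto n p U g"
  shows "smooth_upto n p U (\<lambda>x. f x * g x)"
  using assms(2,3)
proof (induction n arbitrary: f g)
  case 0
  then show ?case by (rule smooth_upto_0_mult)
next
  case (Suc n)
  have "smooth_upto n p U (pd i (\<lambda>x. f x * g x))" if "i < p" for i
  proof (rule smooth_upto_cong[OF assms(1) pd_mult[OF Suc.prems _ that, symmetric]])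
    show "smooth_upto n p U (\<lambda>x. pd i f x * g x + f x * pd i g x)"
      using Suc.prems[THEN smooth_upto_SucD] Suc.prems that
      by (intro smooth_upto_add[OF assms(1)] Suc.IH) (auto simp: smooth_upto_Suc)
  qed auto
  then show ?case
    using Suc.prems smooth_upto_0_mult by (auto simp: smooth_upto_Suc)
qed

lemma
  assumes U: "open_Rn p U" and V: "open_Rn q V"
    and g: "\<And>x. x \<in> U \<Longrightarrow> g x \<in> V" "\<And>a. a < q \<Longrightarrow> smooth_upto n p U (\<lambda>x. g x a)"
    and h: "smooth_upto (Suc m) q V h" and x: "x \<in> U" and i: "i < p"
  shows comp_partial_derivative:
      "((\<lambda>t. h (g (x(i := x i + t)))) has_real_derivative
        (\<Sum>a<q. pd a h (g x) * pd i (\<lambda>x. g x a) x)) (at 0)"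
    and pd_comp: "pd i (\<lambda>x. h (g x)) x = (\<Sum>a<q. pd a h (g x) * pd i (\<lambda>x. g x a) x)"
proof -
  show *: "((\<lambda>t. h (g (x(i := x i + t)))) has_real_derivative
      (\<Sum>a<q. pd a h (g x) * pd i (\<lambda>x. g x a) x)) (at 0)"
  proof -
    have "((\<lambda>t. h (g (x(i := x i + t)))) has_real_derivative
        (\<Sum>a<q. pd a h (g (x(i := x i + 0))) * pd i (\<lambda>x. g x a) x)) (at 0)"
    proof (rule chain_rule_pd[OF V])
      show "\<forall>\<^sub>F t in nhds 0. g (x(i := x i + t)) \<in> V"
        using open_Rn_coordinate_line[OF U x i] by eventually_elim (rule g(1))
      show "((\<lambda>t. g (x(i := x i + t)) a) has_real_derivative pd i (\<lambda>x. g x a) x) (at 0)" if "a < q" for a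
        by (rule pd_deriv_smooth_upto[OF g(2)[OF that] x i])
      show "(\<lambda>t. h (v(a := v a + t))) differentiable (at 0)" if "a < q" "v \<in> V" for a v
        using h that by (auto simp: smooth_upto_Suc smooth_upto_0)
      show "continuous_on V (pd a h)" if "a < q" for a
      proof -
        have "smooth_upto 0 q V (pd a h)"
          using h that by (auto simp: smooth_upto_Suc intro: smooth_upto_mono)
        then show ?thesis
          by (simp add: smooth_upto_0)
      qed
    qed
    then show ?thesis
      by simp
  qed
  show "pd i (\<lambda>x. h (g x)) x = (\<Sum>a<q. pd a h (g x) * pd i (\<lambda>x. g x a) x)"
    by (rule pd_eqI[OF *])
qed

lemma continuous_on_Rn_valued:
  assumes "\<And>x. x \<in> U \<Longrightarrow> g x \<in> Rn q" "\<And>a. a < q \<Longrightarrow> continuous_on U (\<lambda>x. g x a)"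
  shows "continuous_on U g"
proof (rule continuous_on_coordinatewise_then_product)
  fix a
  show "continuous_on U (\<lambda>x. g x a)"
  proof (cases "a < q")
    case False
    then have "\<And>x. x \<in> U \<Longrightarrow> g x a = 0"
      using assms(1) by (auto simp: Rn_def)
    then show ?thesis
      using continuous_on_cong[of U U "\<lambda>x. g x a" "\<lambda>x. 0"] by simp
  qed (rule assms(2))
qed

text \<open>The chain rule consumes continuous first partial derivatives of h, so h is taken one
  order smoother than the result. For smooth maps, where all orders are available, the loss is
  harmless.\<close>

lemma smooth_upto_comp:
  assumes U: "open_Rn p U" and V: "open_Rn q V"
    and g: "\<And>x. x \<in> U \<Longrightarrow> g x \<in> V" "\<And>a. a < q \<Longrightarrow> smooth_upto n p U (\<lambda>x. g x a)"
    and h: "smooth_upto (Suc n) q V h"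
  shows "smooth_upto n p U (\<lambda>x. h (g x))"
  using g(2) h
proof (induction n arbitrary: h)
  case 0
  have "continuous_on U g"
    using g(1) open_Rn_subset[OF V] 0(1) by (intro continuous_on_Rn_valued[of U g q]) (auto simp: smooth_upto_0)
  moreover have "continuous_on V h"
    using 0(2) by (simp add: smooth_upto_Suc smooth_upto_0)
  ultimately have "continuous_on U (\<lambda>x. h (g x))"
    using continuous_on_compose2[of V h U g] g(1) by blast
  then show ?case
    using comp_partial_derivative[OF U V g(1) 0(1) 0(2)]
    unfolding smooth_upto_0 real_differentiable_def by blast
next
  case (Suc n)
  have IH: "smooth_upto n p U (\<lambda>x. h (g x))" if "smooth_upto (Suc n) q V h" for h
    using Suc.IH[OF _ that] Suc.prems(1) smooth_upto_SucD by blast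
  have "smooth_upto n p U (pd i (\<lambda>x. h (g x)))" if i: "i < p" for i
  proof (rule smooth_upto_cong[OF U pd_comp[OF U V g(1) Suc.prems _ i, symmetric]])
    show "smooth_upto n p U (\<lambda>x. \<Sum>a<q. pd a h (g x) * pd i (\<lambda>x. g x a) x)"
    proof (intro smooth_upto_sum[OF U] smooth_upto_mult[OF U])
      fix a assume "a \<in> {..<q}"
      then show "smooth_upto n p U (\<lambda>x. pd a h (g x))"
        using Suc.prems(2) by (intro IH) (subst (asm) smooth_upto_Suc, auto)
      show "smooth_upto n p U (pd i (\<lambda>x. g x a))"
        using \<open>a \<in> {..<q}\<close> Suc.prems(1)[of a] i by (auto simp: smooth_upto_Suc)
    qed auto
  qed auto
  moreover have "smooth_upto 0 p U (\<lambda>x. h (g x))"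
    using IH[OF smooth_upto_SucD[OF Suc.prems(2)]] by (rule smooth_upto_mono) simp
  ultimately show ?case
    by (simp add: smooth_upto_Suc)
qed

subsection \<open>Majorants\<close>

text \<open>The factorial is chosen so that passing from f to \<open>pd i f\<close> corresponds to
  passing from P to \<open>fps_deriv P\<close>. One series serves all directions i.\<close>

definition majorized_upto ::
    "nat \<Rightarrow> nat \<Rightarrow> ((nat \<Rightarrow> real) \<Rightarrow> real) \<Rightarrow> (nat \<Rightarrow> real) \<Rightarrow> real fps \<Rightarrow> bool" where
  "majorized_upto n p f x P \<longleftrightarrow>
     (\<forall>is. set is \<subseteq> {..<p} \<and> length is \<le> n \<longrightarrow> \<bar>pds is f x\<bar> \<le> fact (length is) * P $ length is)"

lemma majorized_upto_0: "majorized_upto 0 p f x P \<longleftrightarrow> \<bar>f x\<bar> \<le> P $ 0"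
  by (simp add: majorized_upto_def)

lemma majorized_upto_Suc:
  "majorized_upto (Suc n) p f x P \<longleftrightarrow>
     \<bar>f x\<bar> \<le> P $ 0 \<and> (\<forall>i<p. majorized_upto n p (pd i f) x (fps_deriv P))"
  unfolding majorized_upto_def all_index_lists_Suc
  by (simp add: pds_append Ball_def algebra_simps)

lemma majorized_upto_mono: "majorized_upto n p f x P \<Longrightarrow> m \<le> n \<Longrightarrow> majorized_upto m p f x P"
  unfolding majorized_upto_def by (meson order_trans)

lemma majorized_upto_SucD: "majorized_upto (Suc n) p f x P \<Longrightarrow> majorized_upto n p f x P"
  by (erule majorized_upto_mono) simp

lemma majorized_upto_cong:
  assumes "open_Rn p U" "\<And>x. x \<in> U \<Longrightarrow> f x = g x" "x \<in> U" "majorized_upto n p f x P"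
  shows "majorized_upto n p g x P"
  unfolding majorized_upto_def
proof (intro allI impI)
  fix "is" assume "is": "set is \<subseteq> {..<p} \<and> length is \<le> n"
  then have "pds is f x = pds is g x"
    using pds_cong[OF assms(1), of f g "is" x] assms(2,3) by blast
  then show "\<bar>pds is g x\<bar> \<le> fact (length is) * P $ length is"
    using assms(4) "is" by (metis majorized_upto_def)
qed

lemma majorized_upto_sum:
  assumes "open_Rn p U" "finite A" "\<And>a. a \<in> A \<Longrightarrow> smooth_upto n p U (f a)" "x \<in> U"
    and "\<And>a. a \<in> A \<Longrightarrow> majorized_upto n p (f a) x (P a)"
  shows "majorized_upto n p (\<lambda>x. \<Sum>a\<in>A. f a x) x (\<Sum>a\<in>A. P a)"
  unfolding majorized_upto_def
proof (intro allI impI)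
  fix "is" assume "is": "set is \<subseteq> {..<p} \<and> length is \<le> n"
  have "\<bar>pds is (\<lambda>x. \<Sum>a\<in>A. f a x) x\<bar> = \<bar>\<Sum>a\<in>A. pds is (f a) x\<bar>"
    using pds_sum[where f = f and A = A and x = x, OF assms(1-3)] "is" assms(4) by simp
  also have "\<dots> \<le> (\<Sum>a\<in>A. \<bar>pds is (f a) x\<bar>)"
    by (rule sum_abs)
  also have "\<dots> \<le> (\<Sum>a\<in>A. fact (length is) * P a $ length is)"
    using "is" assms(5) by (intro sum_mono) (auto simp: majorized_upto_def)
  also have "\<dots> = fact (length is) * (\<Sum>a\<in>A. P a) $ length is"
    by (simp add: fps_sum_nth sum_distrib_left)
  finally show "\<bar>pds is (\<lambda>x. \<Sum>a\<in>A. f a x) x\<bar> \<le> fact (length is) * (\<Sum>a\<in>A. P a) $ length is" .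
qed

lemma majorized_upto_add:
  assumes "open_Rn p U" "smooth_upto n p U f" "smooth_upto n p U g" "x \<in> U"
    and "majorized_upto n p f x P" "majorized_upto n p g x Q"
  shows "majorized_upto n p (\<lambda>x. f x + g x) x (P + Q)"
  using majorized_upto_sum[OF assms(1), of UNIV n "\<lambda>b. if b then f else g" x "\<lambda>b. if b then P else Q"] assms
  by (simp add: UNIV_bool add.commute)

text \<open>Leibniz's rule and the derivative of a product of series match term by term, so the
  induction meets no binomial sums. The sign condition for multiplying the bounds comes for free,
  since a majorant of an absolute value is nonnegative.\<close>

lemma majorized_upto_mult:
  assumes "open_Rn p U" "x \<in> U" "smooth_upto n p U f" "smooth_upto n p U g"
    and "majorized_upto n p f x P" "majorized_upto n p g x Q"
  shows "majorized_upto n p (\<lambda>x. f x * g x) x (P * Q)"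
  using assms(3-)
proof (induction n arbitrary: f g P Q)
  case 0
  then show ?case
    by (auto simp: majorized_upto_0 abs_mult intro!: mult_mono)
next
  case (Suc n)
  have "majorized_upto n p (pd i (\<lambda>x. f x * g x)) x (fps_deriv (P * Q))" if i: "i < p" for i
  proof (rule majorized_upto_cong[OF assms(1) pd_mult[OF Suc.prems(1,2) _ i, symmetric] assms(2)])
    have f': "smooth_upto n p U (pd i f)" "majorized_upto n p (pd i f) x (fps_deriv P)"
      using Suc.prems i by (auto simp: smooth_upto_Suc majorized_upto_Suc)
    have g': "smooth_upto n p U (pd i g)" "majorized_upto n p (pd i g) x (fps_deriv Q)"
      using Suc.prems i by (auto simp: smooth_upto_Suc majorized_upto_Suc)
    note fg = Suc.prems(1,2)[THEN smooth_upto_SucD] Suc.prems(3,4)[THEN majorized_upto_SucD]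
    have "majorized_upto n p (\<lambda>x. pd i f x * g x + f x * pd i g x) x (fps_deriv P * Q + P * fps_deriv Q)"
      by (intro majorized_upto_add[OF assms(1)] smooth_upto_mult[OF assms(1)] Suc.IH assms(2) fg f' g')
    then show "majorized_upto n p (\<lambda>x. pd i f x * g x + f x * pd i g x) x (fps_deriv (P * Q))"
      by (simp add: algebra_simps)
  qed auto
  moreover have "\<bar>f x * g x\<bar> \<le> (P * Q) $ 0"
    using Suc.prems(3,4) by (auto simp: majorized_upto_Suc abs_mult intro!: mult_mono)
  ultimately show ?case
    by (simp add: majorized_upto_Suc)
qed

text \<open>The chain rule for formal power series has the same shape as the one for
  \<^term>\<open>\<lambda>x. h (g x)\<close>, so the Faa di Bruno formula is never needed.\<close>

lemma majorized_upto_comp: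
  assumes U: "open_Rn p U" and V: "open_Rn q V" and x: "x \<in> U"
    and g: "\<And>x. x \<in> U \<Longrightarrow> g x \<in> V" "\<And>a. a < q \<Longrightarrow> smooth_upto n p U (\<lambda>x. g x a)"
    and g': "\<And>a i. a < q \<Longrightarrow> i < p \<Longrightarrow> majorized_upto n p (pd i (\<lambda>x. g x a)) x (fps_deriv G)"
    and G0: "G $ 0 = 0"
    and h: "smooth_upto (Suc n) q V h" "majorized_upto n q h (g x) P"
  shows "majorized_upto n p (\<lambda>x. h (g x)) x (P oo (fps_const (real q) * G))"
  using g(2) g' h
proof (induction n arbitrary: h P)
  case 0
  then show ?case
    by (simp add: majorized_upto_0)
next
  case (Suc n)
  let ?G = "fps_const (real q) * G"
  have g_n: "smooth_upto n p U (\<lambda>x. g x a)" if "a < q" for a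
    using Suc.prems(1)[OF that] by (rule smooth_upto_SucD)
  \<comment> \<open>The chain rule sums over q components with the same majorant G; this is the
    origin of \<open>real q\<close> in \<open>?G\<close>. Differentiating a composed series requires
    \<open>G $ 0 = 0\<close>, which is possible because g is majorized only through its first
    partial derivatives.\<close>
  have deriv: "fps_deriv (P oo ?G) = (\<Sum>a<q. (fps_deriv P oo ?G) * fps_deriv G)"
    using G0 by (simp add: fps_compose_deriv algebra_simps fps_of_nat)
  have "majorized_upto n p (pd i (\<lambda>x. h (g x))) x (fps_deriv (P oo ?G))" if i: "i < p" for i
    unfolding deriv
  proof (rule majorized_upto_cong[OF U pd_comp[OF U V g(1) Suc.prems(1,3) _ i, symmetric] x])
    have *: "smooth_upto n p U (\<lambda>x. pd a h (g x))" "smooth_upto n p U (pd i (\<lambda>x. g x a))"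
      "majorized_upto n p (\<lambda>x. pd a h (g x)) x (fps_deriv P oo ?G)"
      "majorized_upto n p (pd i (\<lambda>x. g x a)) x (fps_deriv G)" if a: "a < q" for a
    proof -
      have h': "smooth_upto (Suc n) q V (pd a h)"
        using Suc.prems(3) a smooth_upto_Suc by blast
      show "smooth_upto n p U (\<lambda>x. pd a h (g x))"
        by (rule smooth_upto_comp[OF U V g(1) g_n h'])
      show "smooth_upto n p U (pd i (\<lambda>x. g x a))"
        using Suc.prems(1)[OF a] i by (simp add: smooth_upto_Suc)
      show "majorized_upto n p (pd i (\<lambda>x. g x a)) x (fps_deriv G)"
        using Suc.prems(2)[OF a i] by (rule majorized_upto_SucD)
      show "majorized_upto n p (\<lambda>x. pd a h (g x)) x (fps_deriv P oo ?G)"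
      proof (rule Suc.IH[OF g_n _ h'])
        show "majorized_upto n p (pd i (\<lambda>x. g x a)) x (fps_deriv G)" if "a < q" "i < p" for a i
          using Suc.prems(2)[OF that] by (rule majorized_upto_SucD)
        show "majorized_upto n q (pd a h) (g x) (fps_deriv P)"
          using Suc.prems(4) a by (simp add: majorized_upto_Suc)
      qed
    qed
    show "majorized_upto n p (\<lambda>x. \<Sum>a<q. pd a h (g x) * pd i (\<lambda>x. g x a) x) x
        (\<Sum>a<q. (fps_deriv P oo ?G) * fps_deriv G)"
      by (intro majorized_upto_sum[OF U] smooth_upto_mult[OF U] majorized_upto_mult[OF U] x *) auto
  qed auto
  moreover have "\<bar>h (g x)\<bar> \<le> (P oo ?G) $ 0"
    using Suc.prems(4) by (simp add: majorized_upto_Suc)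
  ultimately show ?case
    by (simp add: majorized_upto_Suc)
qed

subsection \<open>Operator norms and partial derivatives\<close>

lemma enorm_n_eq_L2_set: "enorm_n n x = L2_set x {..<n}"
  by (simp add: enorm_n_def L2_set_def)

lemma abs_le_enorm_n: "i < n \<Longrightarrow> \<bar>x i\<bar> \<le> enorm_n n x"
  unfolding enorm_n_eq_L2_set using member_le_L2_set[of "{..<n}" i "\<lambda>i. \<bar>x i\<bar>"]
  by (simp add: L2_set_def)

definition unit_tuples :: "nat \<Rightarrow> nat \<Rightarrow> (nat \<Rightarrow> real) list set" where
  "unit_tuples p k = {hs. length hs = k \<and> (\<forall>h\<in>set hs. h \<in> Rn p \<and> enorm_n p h \<le> 1)}"

lemma enorm_Dk_le:
  assumes "\<And>is j. set is \<subseteq> {..<p} \<Longrightarrow> length is = k \<Longrightarrow> j < m \<Longrightarrow> \<bar>pds is (\<lambda>y. f y j) x\<bar> \<le> A"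
    and "hs \<in> unit_tuples p k"
  shows "enorm_n m (Dk p f k x hs) \<le> real m * real p ^ k * A"
proof -
  have "\<bar>Dk p f k x hs j\<bar> \<le> real p ^ k * A" if j: "j < m" for j
  proof -
    have "\<bar>Dk p f k x hs j\<bar> \<le> (\<Sum>is | length is = k \<and> set is \<subseteq> {..<p}.
        \<bar>pds is (\<lambda>y. f y j) x * (\<Prod>l<k. (hs ! l) (is ! l))\<bar>)"
      unfolding Dk_def by (rule sum_abs)
    also have "\<dots> \<le> (\<Sum>is | length is = k \<and> set is \<subseteq> {..<p}. A)"
    proof (rule sum_mono)
      fix "is" assume "is \<in> {is. length is = k \<and> set is \<subseteq> {..<p}}"
      then have "is": "length is = k" "set is \<subseteq> {..<p}"
        by auto
      have "\<bar>(hs ! l) (is ! l)\<bar> \<le> 1" if "l < k" for l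
      proof -
        have "is ! l < p"
          using "is" that by (meson lessThan_iff nth_mem subsetD)
        moreover have "enorm_n p (hs ! l) \<le> 1"
          using assms(2) that by (auto simp: unit_tuples_def)
        ultimately show ?thesis
          using abs_le_enorm_n order_trans by blast
      qed
      then have "\<bar>\<Prod>l<k. (hs ! l) (is ! l)\<bar> \<le> 1"
        unfolding abs_prod by (intro prod_le_1) auto
      moreover have "\<bar>pds is (\<lambda>y. f y j) x\<bar> \<le> A"
        using assms(1) "is" j by blast
      ultimately show "\<bar>pds is (\<lambda>y. f y j) x * (\<Prod>l<k. (hs ! l) (is ! l))\<bar> \<le> A"
        unfolding abs_mult using mult_mono[of "\<bar>pds is (\<lambda>y. f y j) x\<bar>" A "\<bar>\<Prod>l<k. (hs ! l) (is ! l)\<bar>" 1]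
        by fastforce
    qed
    also have "\<dots> = real p ^ k * A"
      using card_lists_length_eq[of "{..<p}" k] by (simp add: conj_commute)
    finally show ?thesis .
  qed
  then have "(\<Sum>j<m. \<bar>Dk p f k x hs j\<bar>) \<le> (\<Sum>j<m. real p ^ k * A)"
    by (intro sum_mono) auto
  moreover have "enorm_n m (Dk p f k x hs) \<le> (\<Sum>j<m. \<bar>Dk p f k x hs j\<bar>)"
    unfolding enorm_n_eq_L2_set by (rule L2_set_le_sum_abs)
  ultimately show ?thesis
    by (simp add: mult.assoc)
qed

lemma dnorm_le:
  assumes "\<And>is j. set is \<subseteq> {..<p} \<Longrightarrow> length is = k \<Longrightarrow> j < m \<Longrightarrow> \<bar>pds is (\<lambda>y. f y j) x\<bar> \<le> A"
  shows "dnorm p m f k x \<le> real m * real p ^ k * A"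
proof -
  have "replicate k (\<lambda>_. 0) \<in> unit_tuples p k"
    by (auto simp: unit_tuples_def Rn_def enorm_n_def)
  then show ?thesis
    unfolding dnorm_def unit_tuples_def[symmetric]
    by (intro cSUP_least enorm_Dk_le assms) auto
qed

text \<open>Evaluating the k-linear form at basis vectors singles out one index list. Since
  \<open>dnorm\<close> is a supremum of reals, its range must first be shown bounded above; the
  crude maximum \<open>?A\<close> serves only for that.\<close>

lemma abs_pds_le_dnorm:
  assumes "set is \<subseteq> {..<p}" "length is = k" "j < m"
  shows "\<bar>pds is (\<lambda>y. f y j) x\<bar> \<le> dnorm p m f k x"
proof -
  let ?I = "{is. set is \<subseteq> {..<p} \<and> length is = k}"
  let ?A = "Max ((\<lambda>(is, j). \<bar>pds is (\<lambda>y. f y j) x\<bar>) ` (?I \<times> {..<m}))"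
  have fin: "finite ?I"
    by (rule finite_lists_length_eq) simp
  have "\<bar>pds is (\<lambda>y. f y j) x\<bar> \<le> ?A" if "set is \<subseteq> {..<p}" "length is = k" "j < m" for "is" j
    by (rule Max_ge) (use fin that in \<open>auto intro!: image_eqI[of _ _ "(is, j)"]\<close>)
  then have bdd: "bdd_above ((\<lambda>hs. enorm_n m (Dk p f k x hs)) ` unit_tuples p k)"
    by (intro bdd_aboveI2[where M = "real m * real p ^ k * ?A"] enorm_Dk_le) auto
  define hs where "hs = map (\<lambda>i l. if l = i then 1 else 0 :: real) is"
  have "(\<Sum>i<p. (if i = a then 1 else 0 :: real)\<^sup>2) = 1" if "a < p" for a
  proof -
    have "(\<Sum>i<p. (if i = a then 1 else 0 :: real)\<^sup>2) = (\<Sum>i<p. if i = a then 1 else 0)"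
      by (rule sum.cong) auto
    then show ?thesis
      using that by simp
  qed
  then have hs: "hs \<in> unit_tuples p k"
    using assms by (auto simp: hs_def unit_tuples_def Rn_def enorm_n_def)
  have "Dk p f k x hs j = (\<Sum>js\<in>{js. length js = k \<and> set js \<subseteq> {..<p}}.
      if js = is then pds js (\<lambda>y. f y j) x else 0)"
    unfolding Dk_def
  proof (rule sum.cong[OF refl])
    fix js assume "js \<in> {js. length js = k \<and> set js \<subseteq> {..<p}}"
    then have js: "length js = k"
      by simp
    have "(\<Prod>l<k. (hs ! l) (js ! l)) = (if js = is then 1 else 0)"
    proof (cases "js = is")
      case True
      then show ?thesis
        using assms(2) by (simp add: hs_def)
    next
      case False
      then obtain l where "l < k" "js ! l \<noteq> is ! l"
        using js assms(2) nth_equalityI by metis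
      then show ?thesis
        using False assms(2) by (auto simp: hs_def intro!: prod_zero)
    qed
    then show "pds js (\<lambda>y. f y j) x * (\<Prod>l<k. (hs ! l) (js ! l)) = (if js = is then pds js (\<lambda>y. f y j) x else 0)"
      by simp
  qed
  also have "\<dots> = pds is (\<lambda>y. f y j) x"
    using assms fin by (subst sum.delta) (auto simp: conj_commute)
  finally have "\<bar>pds is (\<lambda>y. f y j) x\<bar> \<le> enorm_n m (Dk p f k x hs)"
    using abs_le_enorm_n[OF assms(3), of "Dk p f k x hs"] by simp
  also have "\<dots> \<le> dnorm p m f k x"
    unfolding dnorm_def unit_tuples_def[symmetric] by (rule cSUP_upper[OF hs bdd])
  finally show ?thesis .
qed

section \<open>Class membership expressed by bounds on partial derivatives\<close>

lemma in_EM_imp_pds_bound: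
  assumes "in_EM p m M K f" "\<And>k. 0 < M k"
  obtains \<rho> B where "\<rho> > 0" "B > 0" "\<And>x is j. x \<in> K \<Longrightarrow> set is \<subseteq> {..<p} \<Longrightarrow> j < m \<Longrightarrow>
    \<bar>pds is (\<lambda>y. f y j) x\<bar> \<le> fact (length is) * (B * \<rho> ^ length is * M (length is))"
proof -
  obtain \<rho> B where *: "\<rho> > 0" "\<And>x k. x \<in> K \<Longrightarrow> dnorm p m f k x \<le> B * (fact k * \<rho>^k * M k)"
    using assms(1) by (auto simp: in_EM_def)
  \<comment> \<open>\<open>in_EM\<close> does not force its constant B to be nonnegative, hence
    \<open>max B 1\<close>.\<close>
  have "\<bar>pds is (\<lambda>y. f y j) x\<bar> \<le> fact (length is) * (max B 1 * \<rho> ^ length is * M (length is))"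
    if "x \<in> K" "set is \<subseteq> {..<p}" "j < m" for x "is" j
  proof -
    let ?k = "length is"
    have "\<bar>pds is (\<lambda>y. f y j) x\<bar> \<le> B * (fact ?k * \<rho>^?k * M ?k)"
      using abs_pds_le_dnorm[OF that(2) refl that(3), of f x] *(2)[OF that(1), of ?k] by linarith
    also have "\<dots> \<le> max B 1 * (fact ?k * \<rho>^?k * M ?k)"
      using *(1) assms(2)[of ?k] by (intro mult_right_mono) (auto intro!: mult_nonneg_nonneg)
    finally show ?thesis
      by (simp add: mult_ac)
  qed
  then show ?thesis
    using that[of \<rho> "max B 1"] *(1) by simp
qed

lemma in_EM_I:
  assumes "\<rho> > 0" "B \<ge> 0" "\<And>k. 0 < M k" "\<And>x is j. x \<in> K \<Longrightarrow> set is \<subseteq> {..<p} \<Longrightarrow> j < m \<Longrightarrow>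
    \<bar>pds is (\<lambda>y. f y j) x\<bar> \<le> fact (length is) * (B * \<rho> ^ length is * M (length is))"
  shows "in_EM p m M K f"
  unfolding in_EM_def
proof (intro exI conjI ballI allI)
  \<comment> \<open>The p^k summands of \<open>Dk\<close> are absorbed by \<rho>; p + 1 instead of p
    keeps the new radius positive for p = 0.\<close>
  show "\<rho> * (real p + 1) > 0"
    using assms(1) by simp
  fix x k assume x: "x \<in> K"
  have "dnorm p m f k x \<le> real m * real p ^ k * (fact k * (B * \<rho> ^ k * M k))"
    by (rule dnorm_le) (use assms(4)[OF x] in blast)
  also have "\<dots> \<le> real m * (real p + 1) ^ k * (fact k * (B * \<rho> ^ k * M k))"
    using assms(1-2) assms(3)[of k] by (intro mult_right_mono mult_left_mono power_mono) auto
  finally show "dnorm p m f k x \<le> real m * B * (fact k * (\<rho> * (real p + 1)) ^ k * M k)"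
    by (simp add: power_mult_distrib mult_ac)
qed

subsection \<open>The composition estimate\<close>

lemma finite_compositions: "finite (compositions k)"
proof (rule finite_subset)
  show "compositions k \<subseteq> {as. set as \<subseteq> {..k} \<and> length as \<le> k}"
  proof
    fix as assume "as \<in> compositions k"
    then have as: "\<forall>a\<in>set as. 0 < a" "sum_list as = k"
      by (auto simp: compositions_def)
    have "length as \<le> sum_list as" if "\<forall>a\<in>set as. 0 < a" for as :: "nat list"
      using that by (induction as) auto
    then show "as \<in> {as. set as \<subseteq> {..k} \<and> length as \<le> k}"
      using as member_le_sum_list by fastforce
  qed
  show "finite {as. set as \<subseteq> {..k} \<and> length as \<le> k}"
    by (rule finite_lists_length_le) simp
qed

lemma composition_le_circ_seq:
  assumes "as \<in> compositions k" "0 < k"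
  shows "M (length as) * prod_list (map M as) \<le> circ_seq M k"
  using assms finite_compositions[of k] by (auto simp: circ_seq_def intro!: Max_ge)

lemma circ_seq_pos:
  assumes "\<And>k. 0 < M k"
  shows "0 < circ_seq M k"
proof (cases "k = 0")
  case False
  then have "M (length [k]) * prod_list (map M [k]) \<le> circ_seq M k"
    by (intro composition_le_circ_seq) (auto simp: compositions_def)
  moreover have "0 < M (length [k]) * prod_list (map M [k])"
    using assms by simp
  ultimately show ?thesis
    by linarith
qed (simp add: circ_seq_def)

text \<open>The coefficient counts the compositions of k into i positive parts. There are at most
  exponentially many, a factor that a change of \<rho> absorbs.\<close>

lemma geometric_power_coeff_le:
  "(Abs_fps (\<lambda>k. if k = 0 then 0 else 1 :: real) ^ i) $ k \<le> 2 ^ k"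
proof (induction i arbitrary: k)
  case 0
  then show ?case
    by simp
next
  case (Suc i)
  let ?E = "Abs_fps (\<lambda>k. if k = 0 then 0 else 1 :: real)"
  have "(?E ^ Suc i) $ k = (\<Sum>j=0..k. ?E ^ i $ j * ?E $ (k - j))"
    unfolding power_Suc2 fps_mult_nth ..
  also have "\<dots> = (\<Sum>j\<in>{..<k}. ?E ^ i $ j)"
    by (rule sum.mono_neutral_cong_right) auto
  also have "\<dots> \<le> (\<Sum>j\<in>{..<k}. 2 ^ j)"
    by (rule sum_mono) (rule Suc)
  also have "\<dots> \<le> 2 ^ k"
    by (simp add: sum_gp_strict)
  finally show ?case .
qed

text \<open>Expanding the power gives one product per i-tuple of sum k. Tuples with a zero entry
  contribute nothing, and each remaining one is a composition of k, whose product with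
  \<open>M i\<close> is a candidate in the maximum defining \<open>circ_seq\<close>. The series of
  ones carries the count.\<close>

lemma compose_power_coeff_le_circ_seq:
  fixes M :: "nat \<Rightarrow> real"
  assumes M: "\<And>k. 0 < M k" and b: "0 \<le> b" and s: "0 \<le> s" and k: "0 < k"
  shows "M i * (Abs_fps (\<lambda>k. if k = 0 then 0 else b * s ^ k * M k) ^ i) $ k
    \<le> b ^ i * s ^ k * circ_seq M k * 2 ^ k"
proof (cases i)
  case 0
  then show ?thesis
    using k s circ_seq_pos[of M k, OF M] by simp
next
  case (Suc m)
  let ?G = "Abs_fps (\<lambda>k. if k = 0 then 0 else b * s ^ k * M k)"
  let ?E = "Abs_fps (\<lambda>k. if k = 0 then 0 else 1 :: real)"
  have pow: "(F ^ i) $ k = (\<Sum>v\<in>natpermute k i. prod_list (map (fps_nth F) v))" for F :: "real fps"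
  proof -
    have "(F ^ i) $ k = (\<Sum>v\<in>natpermute k (Suc m). \<Prod>j=0..m. F $ (v ! j))"
      using fps_power_nth_Suc[of F m k] unfolding Suc Suc_eq_plus1 .
    also have "\<dots> = (\<Sum>v\<in>natpermute k i. prod_list (map (fps_nth F) v))"
      unfolding Suc
    proof (rule sum.cong[OF refl])
      fix v assume "v \<in> natpermute k (Suc m)"
      then have "length v = Suc m"
        by (simp add: natpermute_def)
      then have "map (fps_nth F) v = map (\<lambda>j. F $ (v ! j)) [0..<Suc m]"
        by (intro nth_equalityI) (auto simp del: upt_Suc)
      then show "(\<Prod>j=0..m. F $ (v ! j)) = prod_list (map (fps_nth F) v)"
        by (simp add: prod.distinct_set_conv_list[symmetric] atLeastLessThanSuc_atLeastAtMost del: upt_Suc)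
    qed
    finally show ?thesis .
  qed
  have termwise: "M i * prod_list (map (fps_nth ?G) v) \<le>
      b ^ i * s ^ k * circ_seq M k * prod_list (map (fps_nth ?E) v)" if v: "v \<in> natpermute k i" for v
  proof (cases "0 \<in> set v")
    case True
    then have "prod_list (map (fps_nth ?G) v) = 0" "prod_list (map (fps_nth ?E) v) = 0"
      by (auto simp: prod_list_zero_iff)
    then show ?thesis
      by simp
  next
    case False
    have len: "length v = i" "sum_list v = k"
      using v by (auto simp: natpermute_def)
    have "prod_list (map (fps_nth ?G) w) = b ^ length w * s ^ sum_list w * prod_list (map M w)
      \<and> prod_list (map (fps_nth ?E) w) = 1" if "0 \<notin> set w" for w
      using that by (induction w) (auto simp: power_add)
    from this[OF False] have "prod_list (map (fps_nth ?G) v) = b ^ i * s ^ k * prod_list (map M v)"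
      "prod_list (map (fps_nth ?E) v) = 1"
      using len by auto
    moreover have "M i * prod_list (map M v) \<le> circ_seq M k"
      using composition_le_circ_seq[of v k M] k len False by (auto simp: compositions_def intro: gr0I)
    then have "b ^ i * s ^ k * (M i * prod_list (map M v)) \<le> b ^ i * s ^ k * circ_seq M k"
      using b s by (intro mult_left_mono) auto
    ultimately show ?thesis
      by (simp add: mult_ac)
  qed
  have "M i * (?G ^ i) $ k = (\<Sum>v\<in>natpermute k i. M i * prod_list (map (fps_nth ?G) v))"
    by (simp add: pow sum_distrib_left)
  also have "\<dots> \<le> (\<Sum>v\<in>natpermute k i. b ^ i * s ^ k * circ_seq M k * prod_list (map (fps_nth ?E) v))"
    by (rule sum_mono) (rule termwise)
  also have "\<dots> = b ^ i * s ^ k * circ_seq M k * (?E ^ i) $ k"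
    by (simp add: pow sum_distrib_left)
  also have "\<dots> \<le> b ^ i * s ^ k * circ_seq M k * 2 ^ k"
    using b s circ_seq_pos[of M k, OF M] geometric_power_coeff_le[of i k] by (intro mult_left_mono) auto
  finally show ?thesis .
qed

text \<open>In the factor 4, one 2 counts compositions and the other bounds the k + 1 summands by
  2^k. The maximum with 1 makes one power k dominate all powers i \<le> k of
  \<open>r * b\<close>.\<close>

lemma compose_coeff_le_circ_seq:
  fixes M :: "nat \<Rightarrow> real"
  assumes M: "\<And>k. 0 < M k" "M 0 = 1" and nonneg: "0 \<le> B" "0 \<le> r" "0 \<le> b" "0 \<le> s"
  shows "(Abs_fps (\<lambda>i. B * r ^ i * M i) oo Abs_fps (\<lambda>k. if k = 0 then 0 else b * s ^ k * M k)) $ k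
    \<le> B * (4 * max 1 (r * b) * s) ^ k * circ_seq M k"
proof (cases "k = 0")
  case True
  then show ?thesis
    by (simp add: M circ_seq_def)
next
  case False
  let ?G = "Abs_fps (\<lambda>k. if k = 0 then 0 else b * s ^ k * M k)"
  have "(Abs_fps (\<lambda>i. B * r ^ i * M i) oo ?G) $ k = (\<Sum>i=0..k. B * r ^ i * (M i * (?G ^ i) $ k))"
    by (simp add: fps_compose_nth mult.assoc)
  also have "\<dots> \<le> (\<Sum>i=0..k. B * max 1 (r * b) ^ k * (s ^ k * circ_seq M k * 2 ^ k))"
  proof (rule sum_mono)
    fix i assume i: "i \<in> {0..k}"
    have "B * r ^ i * (M i * (?G ^ i) $ k) \<le> B * r ^ i * (b ^ i * s ^ k * circ_seq M k * 2 ^ k)"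
      using False nonneg by (intro mult_left_mono compose_power_coeff_le_circ_seq M) auto
    also have "\<dots> = B * (r * b) ^ i * (s ^ k * circ_seq M k * 2 ^ k)"
      by (simp add: power_mult_distrib mult_ac)
    also have "\<dots> \<le> B * max 1 (r * b) ^ k * (s ^ k * circ_seq M k * 2 ^ k)"
    proof (intro mult_right_mono mult_left_mono)
      have "(r * b) ^ i \<le> max 1 (r * b) ^ i"
        using nonneg by (intro power_mono) auto
      also have "\<dots> \<le> max 1 (r * b) ^ k"
        using i by (intro power_increasing) auto
      finally show "(r * b) ^ i \<le> max 1 (r * b) ^ k" .
    qed (use nonneg circ_seq_pos[of M k, OF M(1)] in auto)
    finally show "B * r ^ i * (M i * (?G ^ i) $ k) \<le> B * max 1 (r * b) ^ k * (s ^ k * circ_seq M k * 2 ^ k)" .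
  qed
  also have "\<dots> = real (Suc k) * (B * max 1 (r * b) ^ k * (s ^ k * circ_seq M k * 2 ^ k))"
    by simp
  also have "\<dots> \<le> 2 ^ k * (B * max 1 (r * b) ^ k * (s ^ k * circ_seq M k * 2 ^ k))"
  proof (rule mult_right_mono)
    show "real (Suc k) \<le> 2 ^ k"
      using less_exp[of k] by (metis Suc_leI of_nat_le_iff of_nat_numeral of_nat_power)
  qed (use nonneg circ_seq_pos[of M k, OF M(1)] in auto)
  also have "\<dots> = B * (4 * max 1 (r * b) * s) ^ k * circ_seq M k"
  proof -
    have "(4::real) ^ k = 2 ^ k * 2 ^ k"
      by (metis numeral_Bit0 mult_2 power_mult_distrib)
    then show ?thesis
      by (simp add: power_mult_distrib mult_ac)
  qed
  finally show ?thesis .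
qed

section \<open>From coefficient estimates to stability under composition\<close>

lemma weight_matrixD:
  assumes "weight_matrix Lam M" "l \<in> Lam"
  shows "0 < M l k" "M l 0 = 1"
    and "m \<in> Lam \<Longrightarrow> l \<le> m \<Longrightarrow> M l k \<le> M m k"
    and "1 \<le> k \<Longrightarrow> (fact k * M l k)^2 \<le> (fact (k-1) * M l (k-1)) * (fact (k+1) * M l (k+1))"
  using assms unfolding weight_matrix_def by blast+

lemma in_EM_mono:
  assumes "in_EM p m M K f" "\<And>k. 0 < M k" "\<And>k. M k \<le> N k"
  shows "in_EM p m N K f"
proof -
  obtain \<rho> B where *: "\<rho> > 0" "B > 0" "\<And>x is j. x \<in> K \<Longrightarrow> set is \<subseteq> {..<p} \<Longrightarrow> j < m \<Longrightarrow>
      \<bar>pds is (\<lambda>y. f y j) x\<bar> \<le> fact (length is) * (B * \<rho> ^ length is * M (length is))"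
    using in_EM_imp_pds_bound[OF assms(1,2)] by blast
  show ?thesis
  proof (rule in_EM_I[where \<rho> = \<rho> and B = B])
    show "0 < N k" for k
      using assms(2,3)[of k] by linarith
    show "\<bar>pds is (\<lambda>y. f y j) x\<bar> \<le> fact (length is) * (B * \<rho> ^ length is * N (length is))"
      if "x \<in> K" "set is \<subseteq> {..<p}" "j < m" for x "is" j
      using *(1,2) assms(3)[of "length is"]
      by (intro order_trans[OF *(3)[OF that]] mult_left_mono) auto
  qed (use * in auto)
qed

lemma smooth_map_continuous_on:
  assumes "smooth_map p q U g"
  shows "continuous_on U g"
proof (rule continuous_on_Rn_valued[of U g q])
  show "continuous_on U (\<lambda>x. g x a)" if "a < q" for a
  proof -
    have "smooth_upto 0 p U (\<lambda>x. g x a)"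
      using assms that by (auto simp: smooth_map_def smooth_scalar_iff_smooth_upto)
    then show ?thesis
      by (simp add: smooth_upto_0)
  qed
qed (use assms in \<open>auto simp: smooth_map_def\<close>)

lemma smooth_map_comp:
  assumes U: "open_Rn p U" and V: "open_Rn q V"
    and g: "smooth_map p q U g" "g ` U \<subseteq> V" and f: "smooth_map q r V f"
  shows "smooth_map p r U (f \<circ> g)"
  unfolding smooth_map_def smooth_scalar_iff_smooth_upto
proof (intro conjI ballI allI impI)
  show "(f \<circ> g) x \<in> Rn r" if "x \<in> U" for x
    using that g f by (auto simp: smooth_map_def)
  fix j n assume "j < r"
  then have "smooth_upto n p U (\<lambda>x. (\<lambda>y. f y j) (g x))"
    using f g by (intro smooth_upto_comp[OF U V, where h = "\<lambda>y. f y j" and g = g])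
      (auto simp: smooth_map_def smooth_scalar_iff_smooth_upto)
  then show "smooth_upto n p U (\<lambda>x. (f \<circ> g) x j)"
    by simp
qed

lemma in_EM_comp:
  assumes U: "open_Rn p U" and V: "open_Rn q V"
    and g: "smooth_map p q U g" "g ` U \<subseteq> V" and f: "smooth_map q r V f"
    and K: "K \<subseteq> U"
    and M: "\<And>k. 0 < M k" "M 0 = 1" and N: "\<And>k. 0 < N k"
    and preceq: "seq_preceq (circ_seq M) N"
    and gK: "in_EM p q M K g" and fK: "in_EM q r M (g ` K) f"
  shows "in_EM p r N K (f \<circ> g)"
proof -
  obtain s Bg where sg: "s > 0" "Bg > 0" "\<And>x is j. x \<in> K \<Longrightarrow> set is \<subseteq> {..<p} \<Longrightarrow> j < q \<Longrightarrow>
      \<bar>pds is (\<lambda>y. g y j) x\<bar> \<le> fact (length is) * (Bg * s ^ length is * M (length is))"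
    using in_EM_imp_pds_bound[OF gK M(1)] by blast
  obtain t Bf where tf: "t > 0" "Bf > 0" "\<And>x is j. x \<in> g ` K \<Longrightarrow> set is \<subseteq> {..<q} \<Longrightarrow> j < r \<Longrightarrow>
      \<bar>pds is (\<lambda>y. f y j) x\<bar> \<le> fact (length is) * (Bf * t ^ length is * M (length is))"
    using in_EM_imp_pds_bound[OF fK M(1)] by blast
  obtain C \<sigma> where C: "C > 0" "\<sigma> > 0" "\<And>k. circ_seq M k \<le> C * \<sigma> ^ k * N k"
    using preceq by (auto simp: seq_preceq_def)
  \<comment> \<open>The constant term is dropped because the inner series of a composition must
    vanish at 0; the values of g play the part of the base point instead.\<close>
  define G where "G = Abs_fps (\<lambda>k. if k = 0 then 0 else Bg * s ^ k * M k)"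
  define P where "P = Abs_fps (\<lambda>k. Bf * t ^ k * M k)"
  define A where "A = 4 * max 1 (t * (real q * Bg)) * s"
  have A: "A > 0"
    using sg(1) by (simp add: A_def)
  show ?thesis
  proof (rule in_EM_I[where \<rho> = "A * \<sigma>" and B = "Bf * C"])
    show "A * \<sigma> > 0" "Bf * C \<ge> 0"
      using A C tf by auto
    fix x "is" j
    assume x: "x \<in> K" and "is": "set is \<subseteq> {..<p}" and j: "j < r"
    let ?k = "length is"
    have "majorized_upto ?k p (\<lambda>x. (\<lambda>y. f y j) (g x)) x (P oo (fps_const (real q) * G))"
    proof (rule majorized_upto_comp[OF U V, where h = "\<lambda>y. f y j" and g = g])
      show "x \<in> U"
        using x K by blast
      show "smooth_upto ?k p U (\<lambda>x. g x a)" if "a < q" for a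
        using g that by (auto simp: smooth_map_def smooth_scalar_iff_smooth_upto)
      show "smooth_upto (Suc ?k) q V (\<lambda>y. f y j)"
        using f j by (auto simp: smooth_map_def smooth_scalar_iff_smooth_upto)
      show "majorized_upto ?k q (\<lambda>y. f y j) (g x) P"
        using tf(3) x j by (auto simp: majorized_upto_def P_def)
      show "majorized_upto ?k p (pd i (\<lambda>x. g x a)) x (fps_deriv G)" if "a < q" "i < p" for a i
        unfolding majorized_upto_def
      proof (intro allI impI)
        fix js assume js: "set js \<subseteq> {..<p} \<and> length js \<le> ?k"
        have "\<bar>pds (js @ [i]) (\<lambda>x. g x a) x\<bar> \<le>
            fact (length (js @ [i])) * (Bg * s ^ length (js @ [i]) * M (length (js @ [i])))"
          by (rule sg(3)) (use x js that in auto)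
        then show "\<bar>pds js (pd i (\<lambda>x. g x a)) x\<bar> \<le> fact (length js) * fps_deriv G $ length js"
          by (simp add: pds_append G_def algebra_simps)
      qed
    qed (use g in \<open>auto simp: G_def\<close>)
    then have "\<bar>pds is (\<lambda>x. (f \<circ> g) x j) x\<bar> \<le> fact ?k * (P oo (fps_const (real q) * G)) $ ?k"
      using "is" by (simp add: majorized_upto_def)
    also have "fps_const (real q) * G = Abs_fps (\<lambda>k. if k = 0 then 0 else (real q * Bg) * s ^ k * M k)"
      by (simp add: G_def fps_eq_iff)
    also have "(P oo Abs_fps (\<lambda>k. if k = 0 then 0 else (real q * Bg) * s ^ k * M k)) $ ?k
        \<le> Bf * A ^ ?k * circ_seq M ?k"
      unfolding P_def A_def by (rule compose_coeff_le_circ_seq) (use M sg tf in auto)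
    also have "\<dots> \<le> Bf * A ^ ?k * (C * \<sigma> ^ ?k * N ?k)"
      using C(3) A tf by (intro mult_left_mono) auto
    also have "\<dots> = Bf * C * (A * \<sigma>) ^ ?k * N ?k"
      by (simp add: power_mult_distrib mult_ac)
    finally show "\<bar>pds is (\<lambda>x. (f \<circ> g) x j) x\<bar> \<le> fact ?k * (Bf * C * (A * \<sigma>) ^ ?k * N ?k)"
      by simp
  qed (rule N)
qed

lemma FdB_imp_stable_comp:
  assumes WM: "weight_matrix Lam M" and FdB: "cond_FdB Lam M"
  shows "stable_comp Lam M"
  unfolding stable_comp_def
proof (intro allI impI)
  fix p q r U V W g f
  assume "open_Rn p U \<and> open_Rn q V \<and> open_Rn r W \<and>
    g \<in> EMat_to Lam M p q U V \<and> f \<in> EMat_to Lam M q r V W"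
  then have U: "open_Rn p U" and V: "open_Rn q V"
    and g: "smooth_map p q U g" "g ` U \<subseteq> V"
      "\<And>K. compact K \<Longrightarrow> K \<subseteq> U \<Longrightarrow> \<exists>l\<in>Lam. in_EM p q (M l) K g"
    and f: "smooth_map q r V f" "f ` V \<subseteq> W"
      "\<And>K. compact K \<Longrightarrow> K \<subseteq> V \<Longrightarrow> \<exists>l\<in>Lam. in_EM q r (M l) K f"
    by (auto simp: EMat_to_def EMat_def)
  have "\<exists>m\<in>Lam. in_EM p r (M m) K (f \<circ> g)" if K: "compact K" "K \<subseteq> U" for K
  proof -
    have "compact (g ` K)"
      using K continuous_on_subset[OF smooth_map_continuous_on[OF g(1)]] by (intro compact_continuous_image)
    moreover have "g ` K \<subseteq> V"
      using g(2) K(2) by blast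
    ultimately obtain l1 l2 where l: "l1 \<in> Lam" "in_EM p q (M l1) K g" "l2 \<in> Lam" "in_EM q r (M l2) (g ` K) f"
      using g(3)[OF K] f(3) by blast
    \<comment> \<open>Two compact sets, K for g and its image for f, may select different weights.
      Indices are real numbers, so the larger of the two lies in \<open>Lam\<close> and works for
      both maps.\<close>
    define l where "l = max l1 l2"
    have lL: "l \<in> Lam"
      using l by (simp add: l_def max_def)
    have gl: "in_EM p q (M l) K g"
      by (rule in_EM_mono[OF l(2)]) (use weight_matrixD[OF WM] l(1) lL in \<open>auto simp: l_def\<close>)
    have fl: "in_EM q r (M l) (g ` K) f"
      by (rule in_EM_mono[OF l(4)]) (use weight_matrixD[OF WM] l(3) lL in \<open>auto simp: l_def\<close>)
    obtain m where m: "m \<in> Lam" "seq_preceq (circ_seq (M l)) (M m)"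
      using FdB lL by (auto simp: cond_FdB_def)
    have "in_EM p r (M m) K (f \<circ> g)"
      by (rule in_EM_comp[OF U V g(1,2) f(1) K(2) _ _ _ m(2) gl fl])
        (use weight_matrixD[OF WM] lL m(1) in auto)
    with m show ?thesis
      by blast
  qed
  moreover have "(f \<circ> g) ` U \<subseteq> W"
    using g(2) f(2) by fastforce
  ultimately show "f \<circ> g \<in> EMat_to Lam M p r U W"
    using smooth_map_comp[OF U V g(1,2) f(1)] by (auto simp: EMat_to_def EMat_def)
qed

subsection \<open>Functions of one variable\<close>

lemma open_Rn_one_dim:
  assumes "open S"
  shows "open_Rn 1 {x \<in> Rn 1. x 0 \<in> S}"
proof -
  have "open ((\<lambda>x :: nat \<Rightarrow> real. x 0) -` S)"
    using assms by (intro open_vimage continuous_on_product_coordinates)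
  moreover have "{x \<in> Rn 1. x 0 \<in> S} = Rn 1 \<inter> (\<lambda>x. x 0) -` S"
    by auto
  ultimately show ?thesis
    unfolding open_Rn_def openin_open by blast
qed

lemma has_real_derivative_coordinate:
  assumes "(\<phi> has_real_derivative D) (at (x 0))"
  shows "((\<lambda>t. \<phi> ((x(0 := x 0 + t)) (0::nat))) has_real_derivative D) (at 0)"
  using assms DERIV_shift[of \<phi> D 0 "x 0"] by (simp add: add.commute)

context
  fixes S :: "real set" and \<phi> :: "nat \<Rightarrow> real \<Rightarrow> real"
  assumes S: "open S"
    and deriv: "\<And>k t. t \<in> S \<Longrightarrow> (\<phi> k has_real_derivative \<phi> (Suc k) t) (at t)"
begin

lemma pds_one_dim:
  assumes "set is \<subseteq> {..<1}" "x \<in> {x \<in> Rn 1. x 0 \<in> S}"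
  shows "pds is (\<lambda>x. \<phi> 0 (x 0)) x = \<phi> (length is) (x 0)"
  using assms
proof (induction "is" arbitrary: x)
  case Nil
  then show ?case
    by simp
next
  case (Cons i "is")
  have i: "i = 0"
    using Cons.prems by simp
  have "pd 0 (pds is (\<lambda>x. \<phi> 0 (x 0))) x = pd 0 (\<lambda>x. \<phi> (length is) (x 0)) x"
    by (rule pd_cong[OF open_Rn_one_dim[OF S] Cons.prems(2)]) (use Cons in auto)
  also have "\<dots> = \<phi> (Suc (length is)) (x 0)"
    using Cons.prems(2) by (intro pd_eqI has_real_derivative_coordinate deriv) auto
  finally show ?case
    by (simp add: i)
qed

lemma smooth_scalar_one_dim: "smooth_scalar 1 {x \<in> Rn 1. x 0 \<in> S} (\<lambda>x. \<phi> 0 (x 0))"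
  unfolding smooth_scalar_def
proof (intro allI impI conjI ballI)
  let ?V = "{x \<in> Rn 1. x 0 \<in> S}"
  fix "is" :: "nat list" assume "is": "set is \<subseteq> {..<1}"
  let ?k = "length is"
  have "continuous_on S (\<phi> ?k)"
    using deriv by (meson DERIV_continuous continuous_at_imp_continuous_on)
  moreover have "continuous_on ?V (\<lambda>x. x 0)"
    by (rule continuous_on_subset[OF continuous_on_product_coordinates]) simp
  ultimately have "continuous_on ?V (\<lambda>x. \<phi> ?k (x 0))"
    by (rule continuous_on_compose2[of S "\<phi> ?k" ?V "\<lambda>x. x 0"]) blast
  then show "continuous_on ?V (pds is (\<lambda>x. \<phi> 0 (x 0)))"
    using continuous_on_cong[of ?V ?V "pds is (\<lambda>x. \<phi> 0 (x 0))" "\<lambda>x. \<phi> ?k (x 0)"] pds_one_dim[OF "is"]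
    by simp
  fix i :: nat and x assume "i < 1" and x: "x \<in> ?V"
  then have i: "i = 0"
    by simp
  have "((\<lambda>t. \<phi> ?k ((x(0 := x 0 + t)) 0)) has_real_derivative \<phi> (Suc ?k) (x 0)) (at 0)"
    using x by (intro has_real_derivative_coordinate deriv) auto
  then show "(\<lambda>t. pds is (\<lambda>x. \<phi> 0 (x 0)) (x(i := x i + t))) differentiable (at 0)"
    unfolding i
    by (intro partially_differentiable_cong[OF open_Rn_one_dim[OF S] x _ pds_one_dim[OF "is", symmetric]])
      (auto simp: real_differentiable_def simp del: fun_upd_apply)
qed

end

text \<open>The family \<open>\<phi>\<close> lists all derivatives in advance, which reduces
  membership to a real-variable estimate on compact subsets of S. It serves both the restriction of
  a holomorphic function to the real line and the cosine series.\<close>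

lemma EMat_one_dim:
  fixes \<phi> :: "nat \<Rightarrow> nat \<Rightarrow> real \<Rightarrow> real"
  assumes S: "open S"
    and deriv: "\<And>j k t. j < m \<Longrightarrow> t \<in> S \<Longrightarrow> (\<phi> j k has_real_derivative \<phi> j (Suc k) t) (at t)"
    and f: "\<And>x j. f x j = (if j < m then \<phi> j 0 (x 0) else 0)"
    and M: "\<And>l k. l \<in> Lam \<Longrightarrow> 0 < M l k"
    and bound: "\<And>K. compact K \<Longrightarrow> K \<subseteq> S \<Longrightarrow> \<exists>l\<in>Lam. \<exists>\<rho>>0. \<exists>B\<ge>0. \<forall>t\<in>K. \<forall>k. \<forall>j<m.
      \<bar>\<phi> j k t\<bar> \<le> fact k * (B * \<rho> ^ k * M l k)"
  shows "f \<in> EMat Lam M 1 m {x \<in> Rn 1. x 0 \<in> S}"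
  unfolding EMat_def
proof (intro CollectI conjI allI impI)
  let ?V = "{x \<in> Rn 1. x 0 \<in> S}"
  have fj: "(\<lambda>x. f x j) = (\<lambda>x. \<phi> j 0 (x 0))" if "j < m" for j
    using that by (simp add: f)
  show "smooth_map 1 m ?V f"
    unfolding smooth_map_def
    using smooth_scalar_one_dim[where \<phi> = "\<phi> j" for j, OF S deriv] by (auto simp: Rn_def f fj)
  fix K assume K: "compact K \<and> K \<subseteq> ?V"
  have "compact ((\<lambda>x. x 0) ` K)"
    using K by (intro compact_continuous_image continuous_on_subset[OF continuous_on_product_coordinates]) auto
  moreover have "(\<lambda>x. x 0) ` K \<subseteq> S"
    using K by auto
  ultimately obtain l \<rho> B where l: "l \<in> Lam" "\<rho> > 0" "B \<ge> 0"
      "\<forall>t\<in>(\<lambda>x. x 0) ` K. \<forall>k. \<forall>j<m. \<bar>\<phi> j k t\<bar> \<le> fact k * (B * \<rho> ^ k * M l k)"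
    using bound by meson
  have "in_EM 1 m (M l) K f"
  proof (rule in_EM_I[OF l(2,3) M[OF l(1)]])
    show "\<bar>pds is (\<lambda>y. f y j) x\<bar> \<le> fact (length is) * (B * \<rho> ^ length is * M l (length is))"
      if "x \<in> K" "set is \<subseteq> {..<1}" "j < m" for x "is" j
    proof -
      have "pds is (\<lambda>y. f y j) x = \<phi> j (length is) (x 0)"
        unfolding fj[OF that(3)] by (rule pds_one_dim[where \<phi> = "\<phi> j", OF S deriv[OF that(3)] that(2)]) (use K that in auto)
      then show ?thesis
        using l(4) that by auto
    qed
  qed
  then show "\<exists>l\<in>Lam. in_EM 1 m (M l) K f"
    using l(1) by blast
qed

subsection \<open>Stability under composition implies holomorphic closedness\<close>

text \<open>A positive lower limit gives M k \<ge> d^k from some index on, so c = 1 / d. The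
  finitely many earlier ratios d^k / M k are absorbed by A.\<close>

lemma cond_Comega_lower_bound:
  assumes WM: "weight_matrix Lam M" and "cond_Comega Lam M"
  obtains l A c where "l \<in> Lam" "A > 0" "c > 0" "\<And>k. 1 \<le> A * c ^ k * M l k"
proof -
  obtain l where l: "l \<in> Lam" "0 < liminf (\<lambda>k. ereal (root k (M l k)))"
    using assms(2) by (auto simp: cond_Comega_def)
  then obtain d where d: "0 < d" "ereal d < liminf (\<lambda>k. ereal (root k (M l k)))"
    using ereal_dense2[of 0] by (metis ereal_less(2))
  have pos: "0 < M l k" for k
    using weight_matrixD(1)[OF WM l(1)] .
  have "\<forall>\<^sub>F k in sequentially. d < root k (M l k)"
    using less_LiminfD[OF d(2)] by simp
  then obtain N where N: "\<And>k. k \<ge> N \<Longrightarrow> d < root k (M l k)"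
    by (auto simp: eventually_sequentially)
  define A where "A = 1 + (\<Sum>k\<le>N. d ^ k / M l k)"
  have A1: "A \<ge> 1"
    unfolding A_def using d pos by (simp add: sum_nonneg less_imp_le)
  have "d ^ k \<le> A * M l k" for k
  proof (cases "k \<le> N")
    case True
    have "d ^ k / M l k \<le> (\<Sum>k\<le>N. d ^ k / M l k)"
      by (rule member_le_sum[where f = "\<lambda>k. d ^ k / M l k"]) (use True d pos in \<open>auto intro!: less_imp_le\<close>)
    then have "d ^ k / M l k \<le> A"
      by (simp add: A_def)
    then show ?thesis
      using pos[of k] by (simp add: field_simps)
  next
    case False
    then have "d ^ k \<le> root k (M l k) ^ k"
      using N[of k] d by (intro power_mono) auto
    also have "\<dots> = M l k"
      using False pos[of k] by (simp add: real_root_pow_pos2)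
    also have "\<dots> \<le> A * M l k"
      using A1 pos[of k] by simp
    finally show ?thesis .
  qed
  then have "1 \<le> A * (1 / d) ^ k * M l k" for k
    using d by (simp add: power_divide field_simps)
  with that[of l A "1 / d"] l A1 d show ?thesis
    by simp
qed

text \<open>Compactness gives one radius e for discs around all points of K, so the Cauchy
  inequalities become uniform.\<close>

lemma holomorphic_derivs_bound:
  assumes F: "F holomorphic_on Om" "open Om" and K: "compact K" "K \<subseteq> Om"
  obtains e B where "e > 0" "B \<ge> 0" "\<And>z k. z \<in> K \<Longrightarrow> norm ((deriv ^^ k) F z) \<le> fact k * (B * (1 / e) ^ k)"
proof -
  obtain e where e: "e > 0" "(\<Union>z\<in>K. cball z e) \<subseteq> Om"
    using compact_subset_open_imp_cball_epsilon_subset[OF K(1) F(2) K(2)] by blast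
  have cont: "continuous_on Om F"
    using F(1) holomorphic_on_imp_continuous_on by blast
  have "compact (F ` (\<Union>z\<in>K. cball z e))"
    by (intro compact_continuous_image continuous_on_subset[OF cont e(2)] compact_minkowski_sum_cball K)
  then obtain B where B: "B > 0" "\<And>w. w \<in> (\<Union>z\<in>K. cball z e) \<Longrightarrow> norm (F w) \<le> B"
    using compact_imp_bounded bounded_pos by (metis image_eqI)
  have "norm ((deriv ^^ k) F z) \<le> fact k * (B * (1 / e) ^ k)" if "z \<in> K" for z k
  proof -
    have sub: "cball z e \<subseteq> Om"
      using e that by blast
    have "norm ((deriv ^^ k) F z) \<le> fact k * B / e ^ k"
    proof (rule Cauchy_inequality)
      show "F holomorphic_on ball z e"
        using F(1) sub holomorphic_on_subset ball_subset_cball by blast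
      show "continuous_on (cball z e) F"
        using cont sub continuous_on_subset by blast
      show "norm (F w) \<le> B" if "norm (z - w) = e" for w
        using that \<open>z \<in> K\<close> by (intro B) (auto simp: dist_norm)
    qed (rule e)
    then show ?thesis
      by (simp add: power_divide)
  qed
  then show ?thesis
    using that[of e B] e B by simp
qed

text \<open>Stability speaks of real maps, so F is restricted to the real points of
  \<open>Om\<close> and read as a map into R^2. Its derivatives along the line are the real and
  imaginary parts of the complex ones.\<close>

lemma stable_comp_imp_holo_closed:
  assumes WM: "weight_matrix Lam M" and Comega: "cond_Comega Lam M" and stable: "stable_comp Lam M"
  shows "holo_closed Lam M"
  unfolding holo_closed_def
proof (intro allI impI)
  fix p U g F Om
  assume "open_Rn p U \<and> g \<in> EMat Lam M p 1 U \<and> open Om \<and>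
    (\<lambda>x. complex_of_real (g x 0)) ` U \<subseteq> Om \<and> F holomorphic_on Om"
  then have U: "open_Rn p U" and g: "g \<in> EMat Lam M p 1 U" and Om: "open Om"
    and range: "\<And>x. x \<in> U \<Longrightarrow> complex_of_real (g x 0) \<in> Om" and F: "F holomorphic_on Om"
    by auto
  define S where "S = complex_of_real -` Om"
  have S: "open S"
    unfolding S_def by (intro open_vimage Om continuous_intros)
  define \<phi> where "\<phi> j k t = (if j = 0 then Re ((deriv ^^ k) F (complex_of_real t))
    else Im ((deriv ^^ k) F (complex_of_real t)))" for j k :: nat and t
  let ?V = "{x \<in> Rn 1. x 0 \<in> S}"
  let ?f = "\<lambda>y :: nat \<Rightarrow> real. c2v (F (complex_of_real (y 0)))"
  have "?f \<in> EMat Lam M 1 2 ?V"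
  proof (rule EMat_one_dim[OF S])
    show "(\<phi> j k has_real_derivative \<phi> j (Suc k) t) (at t)" if "j < 2" "t \<in> S" for j k t
    proof -
      have "((deriv ^^ k) F has_field_derivative deriv ((deriv ^^ k) F) (complex_of_real t)) (at (complex_of_real t))"
        using that(2) Om F by (intro holomorphic_derivI[of _ Om] holomorphic_higher_deriv) (auto simp: S_def)
      then have "((\<lambda>t. (deriv ^^ k) F (complex_of_real t)) has_vector_derivative
          (deriv ^^ Suc k) F (complex_of_real t)) (at t)"
        by (simp add: has_vector_derivative_real_field)
      then show ?thesis
        unfolding \<phi>_def by (auto intro: has_field_derivative_Re has_field_derivative_Im simp del: funpow.simps)
    qed
    show "?f x j = (if j < 2 then \<phi> j 0 (x 0) else 0)" for x j
      by (auto simp: c2v_def \<phi>_def)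
    show "0 < M l k" if "l \<in> Lam" for l k
      using weight_matrixD(1)[OF WM that] .
    fix K assume K: "compact K" "K \<subseteq> S"
    have "compact (complex_of_real ` K)"
      by (intro compact_continuous_image continuous_intros K)
    moreover have "complex_of_real ` K \<subseteq> Om"
      using K by (auto simp: S_def)
    ultimately obtain e B where e: "e > 0" "B \<ge> 0"
      "\<And>z k. z \<in> complex_of_real ` K \<Longrightarrow> norm ((deriv ^^ k) F z) \<le> fact k * (B * (1 / e) ^ k)"
      using holomorphic_derivs_bound[OF F Om] by metis
    obtain l A c where l: "l \<in> Lam" "A > 0" "c > 0" "\<And>k. 1 \<le> A * c ^ k * M l k"
      using cond_Comega_lower_bound[OF WM Comega] by blast
    have "\<bar>\<phi> j k t\<bar> \<le> fact k * (B * A * (1 / e * c) ^ k * M l k)" if "t \<in> K" for t k j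
    proof -
      have "\<bar>\<phi> j k t\<bar> \<le> norm ((deriv ^^ k) F (complex_of_real t))"
        unfolding \<phi>_def using abs_Re_le_cmod abs_Im_le_cmod by simp
      also have "\<dots> \<le> fact k * (B * (1 / e) ^ k)"
        by (rule e(3)) (use that in blast)
      also have "\<dots> \<le> fact k * (B * (1 / e) ^ k) * (A * c ^ k * M l k)"
        using mult_left_mono[OF l(4), of "fact k * (B * (1 / e) ^ k)" k] e by simp
      also have "\<dots> = fact k * (B * A * (1 / e * c) ^ k * M l k)"
        by (simp only: power_mult_distrib mult_ac)
      finally show ?thesis .
    qed
    moreover have "1 / e * c > 0" "B * A \<ge> 0"
      using e l by auto
    ultimately show "\<exists>l\<in>Lam. \<exists>\<rho>>0. \<exists>B\<ge>0. \<forall>t\<in>K. \<forall>k. \<forall>j<2. \<bar>\<phi> j k t\<bar> \<le> fact k * (B * \<rho> ^ k * M l k)"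
      using l(1) by blast
  qed
  moreover have "?f y \<in> Rn 2" for y
    by (auto simp: c2v_def Rn_def)
  ultimately have f: "?f \<in> EMat_to Lam M 1 2 ?V (Rn 2)"
    by (auto simp: EMat_to_def)
  have "g x \<in> Rn 1" if "x \<in> U" for x
    using g that by (auto simp: EMat_def smooth_map_def)
  then have "g \<in> EMat_to Lam M p 1 U ?V"
    using g range by (auto simp: EMat_to_def S_def)
  moreover have "open_Rn 2 (Rn 2)"
    by (simp add: open_Rn_def)
  ultimately have "?f \<circ> g \<in> EMat_to Lam M p 2 U (Rn 2)"
    using stable U open_Rn_one_dim[OF S] f unfolding stable_comp_def by blast
  then show "(\<lambda>x. c2v (F (complex_of_real (g x 0)))) \<in> EMat Lam M p 2 U"
    by (simp add: EMat_to_def comp_def)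
qed

subsection \<open>From the root condition to the Faa di Bruno condition\<close>

text \<open>The next proof compares two weights with a third, using one constant. Powers replace
  roots so that j = 0, where both sides are 1, is included.\<close>

lemma cond_root_power_bound:
  assumes WM: "weight_matrix Lam M" and root: "cond_root Lam M" and l: "l \<in> Lam" "m \<in> Lam"
  obtains n D where "n \<in> Lam" "D \<ge> 1"
    "\<And>j k. j \<le> k \<Longrightarrow> 0 < k \<Longrightarrow> M l j \<le> (D * root k (M n k)) ^ j"
    "\<And>j k. j \<le> k \<Longrightarrow> 0 < k \<Longrightarrow> M m j \<le> (D * root k (M n k)) ^ j"
proof -
  obtain n1 C1 where n1: "n1 \<in> Lam" "C1 > 0"
    "\<And>j k. 1 \<le> j \<Longrightarrow> j \<le> k \<Longrightarrow> root j (M l j) \<le> C1 * root k (M n1 k)"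
    using root l unfolding cond_root_def by meson
  obtain n2 C2 where n2: "n2 \<in> Lam" "C2 > 0"
    "\<And>j k. 1 \<le> j \<Longrightarrow> j \<le> k \<Longrightarrow> root j (M m j) \<le> C2 * root k (M n2 k)"
    using root l unfolding cond_root_def by meson
  define n where "n = max n1 n2"
  define D where "D = max 1 (max C1 C2)"
  have n: "n \<in> Lam"
    using n1 n2 by (simp add: n_def max_def)
  have *: "M a j \<le> (D * root k (M n k)) ^ j"
    if a: "a \<in> Lam" "\<And>j k. 1 \<le> j \<Longrightarrow> j \<le> k \<Longrightarrow> root j (M a j) \<le> C * root k (M b k)"
      and b: "b \<in> Lam" "b \<le> n" "C \<le> D" and jk: "j \<le> k" "0 < k" for a b C j k
  proof (cases "j = 0")
    case True
    then show ?thesis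
      using weight_matrixD(2)[OF WM a(1)] by simp
  next
    case False
    have pos: "0 < root k (M n k)"
      using weight_matrixD(1)[OF WM n] jk by simp
    have "root k (M b k) \<le> root k (M n k)"
      using weight_matrixD(3)[OF WM b(1) n b(2)] jk by simp
    moreover have "0 < root k (M b k)"
      using weight_matrixD(1)[OF WM b(1)] jk by simp
    ultimately have "C * root k (M b k) \<le> D * root k (M n k)"
      using b(3) by (intro mult_mono) (auto simp: D_def)
    then have "root j (M a j) \<le> D * root k (M n k)"
      using a(2)[of j k] jk False by linarith
    then have "root j (M a j) ^ j \<le> (D * root k (M n k)) ^ j"
      using False weight_matrixD(1)[OF WM a(1), of j] by (intro power_mono) auto
    then show ?thesis
      using False weight_matrixD(1)[OF WM a(1), of j] by (simp add: real_root_pow_pos2)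
  qed
  show ?thesis
  proof (rule that[OF n])
    show "D \<ge> 1"
      by (simp add: D_def)
    show "M l j \<le> (D * root k (M n k)) ^ j" if "j \<le> k" "0 < k" for j k
      by (rule *[OF l(1) n1(3) n1(1) _ _ that]) (auto simp: n_def D_def)
    show "M m j \<le> (D * root k (M n k)) ^ j" if "j \<le> k" "0 < k" for j k
      by (rule *[OF l(2) n2(3) n2(1) _ _ that]) (auto simp: n_def D_def)
  qed
qed

text \<open>Put R = root k (M n k). Up to a constant to the same power, each part a contributes at
  most R^(a-1) and the outer factor R^j, where j is the number of parts. The exponents add up to (k
  - j) + j = k, and R^k = M n k. Bounding \<open>M l a\<close> by the a-th power directly would
  leave a surplus R^j.\<close>

lemma root_imp_FdB:
  assumes WM: "weight_matrix Lam M" and dc: "cond_dc Lam M" and root: "cond_root Lam M"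
  shows "cond_FdB Lam M"
  unfolding cond_FdB_def
proof
  fix l assume l: "l \<in> Lam"
  obtain m C where m: "m \<in> Lam" "\<And>k. M l (k + 1) \<le> C ^ k * M m k"
    using dc l unfolding cond_dc_def by blast
  obtain n D where n: "n \<in> Lam" "D \<ge> 1"
    "\<And>j k. j \<le> k \<Longrightarrow> 0 < k \<Longrightarrow> M l j \<le> (D * root k (M n k)) ^ j"
    "\<And>j k. j \<le> k \<Longrightarrow> 0 < k \<Longrightarrow> M m j \<le> (D * root k (M n k)) ^ j"
    using cond_root_power_bound[OF WM root l m(1)] by blast
  \<comment> \<open>\<open>cond_dc\<close> leaves the sign of C open, hence the absolute value. The
    maximum with 1 gives E \<ge> D, needed for the outer factor.\<close>
  define E where "E = max 1 \<bar>C\<bar> * D"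
  have "1 * D \<le> max 1 \<bar>C\<bar> * D"
    using n(2) by (intro mult_right_mono) auto
  then have E: "E \<ge> D" "E \<ge> 1"
    using n(2) unfolding E_def by linarith+
  have "M l (length as) * prod_list (map (M l) as) \<le> E ^ k * M n k" if as: "as \<in> compositions k" and k: "0 < k" for as k
  proof -
    define R where "R = root k (M n k)"
    have R: "R > 0" "R ^ k = M n k"
      using k weight_matrixD(1)[OF WM n(1), of k] by (auto simp: R_def real_root_pow_pos2)
    have prod_pos: "0 < prod_list (map (M l) bs)" for bs
      by (induction bs) (simp_all add: weight_matrixD(1)[OF WM l])
    have dc_step: "M l a \<le> (E * R) ^ (a - 1)" if a: "0 < a" "a \<le> k" for a
    proof -
      have "M l a \<le> C ^ (a - 1) * M m (a - 1)"
        using m(2)[of "a - 1"] a by simp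
      also have "\<dots> \<le> \<bar>C\<bar> ^ (a - 1) * M m (a - 1)"
        using weight_matrixD(1)[OF WM m(1), of "a - 1"] by (intro mult_right_mono) (auto simp: power_abs[symmetric])
      also have "\<dots> \<le> max 1 \<bar>C\<bar> ^ (a - 1) * (D * R) ^ (a - 1)"
        using n(4)[of "a - 1" k] a k weight_matrixD(1)[OF WM m(1), of "a - 1"]
        by (intro mult_mono power_mono) (auto simp: R_def)
      also have "\<dots> = (E * R) ^ (a - 1)"
        by (simp only: E_def power_mult_distrib mult.assoc)
      finally show ?thesis .
    qed
    \<comment> \<open>The inequality between length and sum is carried along because the exponent is
      a truncated difference.\<close>
    have "prod_list (map (M l) bs) \<le> (E * R) ^ (sum_list bs - length bs) \<and> length bs \<le> sum_list bs"
      if "\<forall>b\<in>set bs. 0 < b \<and> b \<le> k" for bs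
      using that
    proof (induction bs)
      case (Cons b bs)
      then have IH: "prod_list (map (M l) bs) \<le> (E * R) ^ (sum_list bs - length bs)" "length bs \<le> sum_list bs"
        and b: "0 < b" "b \<le> k"
        by auto
      have "M l b * prod_list (map (M l) bs) \<le> (E * R) ^ (b - 1) * (E * R) ^ (sum_list bs - length bs)"
        using dc_step[OF b] IH(1) E R prod_pos[of bs] by (intro mult_mono) auto
      also have "\<dots> = (E * R) ^ (sum_list (b # bs) - length (b # bs))"
        using b IH(2) by (simp add: power_add[symmetric])
      finally show ?case
        using IH(2) b by simp
    qed simp
    moreover have "\<forall>b\<in>set as. 0 < b \<and> b \<le> k" and sum: "sum_list as = k"
      using as member_le_sum_list by (auto simp: compositions_def)
    ultimately have prod: "prod_list (map (M l) as) \<le> (E * R) ^ (k - length as)" and len: "length as \<le> k"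
      by auto
    have "M l (length as) \<le> (D * R) ^ length as"
      using n(3)[OF len k] by (simp add: R_def)
    also have "\<dots> \<le> (E * R) ^ length as"
      using E R n(2) by (intro power_mono mult_right_mono) auto
    finally have "M l (length as) * prod_list (map (M l) as) \<le> (E * R) ^ length as * (E * R) ^ (k - length as)"
      using prod E R prod_pos[of as] by (intro mult_mono) auto
    also have "\<dots> = (E * R) ^ k"
      using len by (simp flip: power_add)
    also have "\<dots> = E ^ k * M n k"
      using R(2) by (simp add: power_mult_distrib)
    finally show ?thesis .
  qed
  then have "circ_seq (M l) k \<le> 1 * E ^ k * M n k" for k
  proof (cases "k = 0")
    case True
    then show ?thesis
      using weight_matrixD(2)[OF WM n(1)] by (simp add: circ_seq_def)
  next
    case False
    have "[k] \<in> compositions k"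
      using False by (simp add: compositions_def)
    then have "circ_seq (M l) k \<in> (\<lambda>as. M l (length as) * prod_list (map (M l) as)) ` compositions k"
      using False finite_compositions[of k] by (auto simp: circ_seq_def intro!: Max_in)
    then show ?thesis
      using False \<open>\<And>as k. as \<in> compositions k \<Longrightarrow> 0 < k \<Longrightarrow> _\<close> by auto
  qed
  then show "\<exists>m\<in>Lam. seq_preceq (circ_seq (M l)) (M m)"
    unfolding seq_preceq_def using n(1) E(2) zero_less_one less_le_trans by blast
qed

subsection \<open>Log-convex sequences\<close>

locale log_convex_sequence =
  fixes N :: "nat \<Rightarrow> real"
  assumes pos: "\<And>k. 0 < N k" and N0: "N 0 = 1"
    and log_convex: "\<And>k. N (Suc k) ^ 2 \<le> N k * N (Suc (Suc k))"
begin

lemma log_convex_quotient_mono: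
  assumes "i \<le> k"
  shows "N (Suc i) / N i \<le> N (Suc k) / N k"
proof (rule lift_Suc_mono_le[OF _ assms])
  show "N (Suc k) / N k \<le> N (Suc (Suc k)) / N (Suc k)" for k
    using log_convex[of k] pos[of k] pos[of "Suc k"] by (simp add: field_simps power2_eq_square)
qed

text \<open>This is the supporting line of the convex sequence log N at k, with slope log (N (k+1) /
  N k). It is multiplied out so that no negative exponent occurs.\<close>

lemma log_convex_tangent: "N k * (N (Suc k) / N k) ^ j \<le> N j * (N (Suc k) / N k) ^ k"
proof (cases "k \<le> j")
  case True
  define q where "q = N (Suc k) / N k"
  have q: "q > 0"
    using pos by (simp add: q_def)
  have "N k * q ^ d \<le> N (k + d)" for d
  proof (induction d)
    case (Suc d)
    have "N k * q ^ Suc d = (N k * q ^ d) * q"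
      by simp
    also have "\<dots> \<le> N (k + d) * (N (Suc (k + d)) / N (k + d))"
      using Suc q pos[of "k + d"] log_convex_quotient_mono[of k "k + d"]
      by (intro mult_mono) (auto simp: q_def less_imp_le)
    also have "\<dots> = N (k + Suc d)"
      using pos[of "k + d"] by simp
    finally show ?case .
  qed simp
  from this[of "j - k"] have "N k * q ^ (j - k) * q ^ k \<le> N j * q ^ k"
    using True q by (intro mult_right_mono) auto
  then show ?thesis
    using True by (simp add: q_def mult.assoc flip: power_add)
next
  case False
  define q where "q = N (Suc k) / N k"
  have q: "q > 0"
    using pos by (simp add: q_def)
  have "N (j + d) \<le> N j * q ^ d" if "j + d \<le> k" for d
    using that
  proof (induction d)
    case (Suc d)
    have "N (j + Suc d) = N (j + d) * (N (Suc (j + d)) / N (j + d))"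
      using pos[of "j + d"] by simp
    also have "\<dots> \<le> (N j * q ^ d) * q"
      using Suc q pos[of j] pos[of "j + d"] pos[of "Suc (j + d)"] log_convex_quotient_mono[of "j + d" k]
      by (intro mult_mono) (auto simp: q_def less_imp_le)
    finally show ?case
      by (simp add: mult_ac)
  qed simp
  from this[of "k - j"] have "N k * q ^ j \<le> N j * q ^ (k - j) * q ^ j"
    using False q by (intro mult_right_mono) auto
  then show ?thesis
    using False by (simp add: q_def mult.assoc flip: power_add)
qed

text \<open>Since N 0 = 1, log (N k) / k is the slope of the chord from 0 to k, which increases for
  a convex sequence.\<close>

lemma root_log_convex_mono:
  assumes "1 \<le> j" "j \<le> k"
  shows "root j (N j) \<le> root k (N k)"
proof -
  have step: "root (Suc i) (N (Suc i)) \<le> root (Suc (Suc i)) (N (Suc (Suc i)))" for i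
  proof -
    let ?n = "Suc i"
    define q where "q = N (Suc ?n) / N ?n"
    have q: "q > 0" "N (Suc ?n) = N ?n * q"
      using pos[of ?n] pos[of "Suc ?n"] by (simp_all add: q_def)
    have "N ?n \<le> q ^ ?n"
      using log_convex_tangent[of ?n 0] N0 by (simp add: q_def)
    then have "N ?n ^ ?n * N ?n \<le> N ?n ^ ?n * q ^ ?n"
      using pos[of ?n] by (intro mult_left_mono) auto
    then have "N ?n ^ Suc ?n \<le> N (Suc ?n) ^ ?n"
      unfolding q(2) power_mult_distrib by (simp add: mult.commute)
    moreover have "N ?n = root ?n (N ?n) ^ ?n" "N (Suc ?n) = root (Suc ?n) (N (Suc ?n)) ^ Suc ?n"
      using pos by (simp_all add: real_root_pow_pos2 less_imp_le del: power_Suc)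
    ultimately have "root ?n (N ?n) ^ (?n * Suc ?n) \<le> root (Suc ?n) (N (Suc ?n)) ^ (Suc ?n * ?n)"
      by (metis power_mult)
    then have "root ?n (N ?n) ^ (?n * Suc ?n) \<le> root (Suc ?n) (N (Suc ?n)) ^ (?n * Suc ?n)"
      by (simp only: mult.commute)
    then show ?thesis
      using power_mono_iff[of "root ?n (N ?n)" "root (Suc ?n) (N (Suc ?n))" "?n * Suc ?n"] pos
      by (simp add: less_imp_le del: power_Suc mult_Suc mult_Suc_right)
  qed
  have "root (Suc (j - 1)) (N (Suc (j - 1))) \<le> root (Suc (k - 1)) (N (Suc (k - 1)))"
    by (rule lift_Suc_mono_le[of "\<lambda>i. root (Suc i) (N (Suc i))", OF step]) (use assms in simp)
  then show ?thesis
    using assms by simp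
qed

end

lemma power_self_le_exp_fact: "real k ^ k \<le> exp 1 ^ k * fact k"
proof -
  have "(\<Sum>n\<in>{k}. inverse (fact n) * real k ^ n) \<le> (\<Sum>n. inverse (fact n) * real k ^ n)"
    by (rule sum_le_suminf[OF summable_exp]) auto
  then have "inverse (fact k) * real k ^ k \<le> exp (real k)"
    by (simp add: exp_def divide_inverse mult.commute)
  moreover have "exp (real k) = exp 1 ^ k"
    using exp_of_nat_mult[of k "1::real"] by simp
  ultimately show ?thesis
    by (simp add: field_simps)
qed

text \<open>Monotone roots are known only for k! M k. Removing the factorials costs little when k
  \<le> 2j: the k-th root of k! is at most k, hence at most 2j, while the j-th root of j! is at
  least j/e. This is the origin of 2e.\<close>

lemma root_weight_le_of_le_double:
  fixes M :: "nat \<Rightarrow> real"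
  assumes M: "\<And>k. 0 < M k"
    and log_convex: "log_convex_sequence (\<lambda>k. fact k * M k)"
    and j: "1 \<le> j" "j \<le> k" "k \<le> 2 * j"
  shows "root j (M j) \<le> 2 * exp 1 * root k (M k)"
proof -
  have j_le: "real j \<le> exp 1 * root j (fact j)"
  proof (rule power_le_imp_le_base)
    show "real j ^ Suc (j - 1) \<le> (exp 1 * root j (fact j)) ^ Suc (j - 1)"
      using power_self_le_exp_fact[of j] j by (simp add: power_mult_distrib real_root_pow_pos2 del: power_Suc)
  qed (use j in auto)
  have "root k (fact k) \<le> root k (real k ^ k)"
    using j fact_le_power[of k, where 'a = real] by simp
  also have "\<dots> = real k"
    using j by (simp add: real_root_power_cancel)
  finally have k_ge: "root k (fact k) \<le> 2 * real j"
    using j by simp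
  have "root j (fact j) * root j (M j) \<le> root k (fact k) * root k (M k)"
    unfolding real_root_mult[symmetric]
    by (rule log_convex_sequence.root_log_convex_mono[OF log_convex j(1,2)])
  also have "\<dots> \<le> 2 * real j * root k (M k)"
    using k_ge M[of k] j by (intro mult_right_mono) (auto simp: less_imp_le)
  also have "\<dots> \<le> 2 * (exp 1 * root j (fact j)) * root k (M k)"
    using j_le M[of k] j by (intro mult_right_mono) (auto simp: less_imp_le)
  finally have "root j (fact j) * root j (M j) \<le> root j (fact j) * (2 * exp 1 * root k (M k))"
    by (simp add: mult_ac)
  then show ?thesis
    using j by (simp add: mult_le_cancel_left_pos)
qed

subsection \<open>A cosine series with large derivatives\<close>

context log_convex_sequence
begin

definition freq :: "nat \<Rightarrow> real" where
  "freq k = N (Suc k) / N k"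

text \<open>Division by \<open>freq k ^ k\<close> normalizes the supporting line at k: the product
  with \<open>freq k ^ j\<close> is at most 2^(-k-1) N j, with equality at j = k.\<close>

definition amp :: "nat \<Rightarrow> real" where
  "amp k = (1/2) ^ Suc k * N k / freq k ^ k"

text \<open>The phase shift by j quarter turns expresses derivatives of every order by one
  formula.\<close>

definition cos_series :: "nat \<Rightarrow> real \<Rightarrow> real" where
  "cos_series j t = (\<Sum>k. amp k * freq k ^ j * cos (freq k * t + real j * (pi / 2)))"

lemma freq_pos: "freq k > 0"
  using pos by (simp add: freq_def)

lemma amp_pos: "amp k > 0"
  using pos freq_pos by (simp add: amp_def)

lemma amp_freq_le: "amp k * freq k ^ j \<le> (1/2) ^ Suc k * N j"
proof -
  have "N k * freq k ^ j / freq k ^ k \<le> N j"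
    using log_convex_tangent[of k j] freq_pos[of k]
    by (simp add: pos_divide_le_eq freq_def)
  then have "(1/2) ^ Suc k * (N k * freq k ^ j / freq k ^ k) \<le> (1/2) ^ Suc k * N j"
    by (intro mult_left_mono) auto
  then show ?thesis
    by (simp add: amp_def)
qed

lemma half_powers_sums: "(\<lambda>k. (1/2) ^ Suc k * c) sums (c :: real)"
  using sums_mult2[OF power_half_series, of c] by simp

lemma cos_term_bound:
  "norm (amp k * freq k ^ j * cos (freq k * t + real j * (pi / 2))) \<le> (1/2) ^ Suc k * N j"
proof -
  have "norm (amp k * freq k ^ j * cos (freq k * t + real j * (pi / 2))) \<le> amp k * freq k ^ j * 1"
    using amp_pos[of k] freq_pos[of k] abs_cos_le_one
    by (simp add: abs_mult mult_left_le)
  then show ?thesis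
    using amp_freq_le[of k j] by linarith
qed

lemma summable_cos_series: "summable (\<lambda>k. amp k * freq k ^ j * cos (freq k * t + real j * (pi / 2)))"
  by (rule summable_comparison_test'[OF sums_summable[OF half_powers_sums] cos_term_bound])

lemma cos_series_bound: "\<bar>cos_series j t\<bar> \<le> N j"
proof -
  have "norm (cos_series j t) \<le> (\<Sum>k. (1/2) ^ Suc k * N j)"
    unfolding cos_series_def
    by (rule norm_suminf_le[OF cos_term_bound]) (rule sums_summable[OF half_powers_sums])
  then show ?thesis
    using sums_unique[OF half_powers_sums[of "N j"]] by simp
qed

lemma cos_series_deriv: "(cos_series j has_real_derivative cos_series (Suc j) t) (at t)"
  unfolding cos_series_def
proof (rule has_field_derivative_series'(2)[of UNIV _ _ 0])
  show "((\<lambda>t. amp k * freq k ^ j * cos (freq k * t + real j * (pi / 2))) has_real_derivative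
      amp k * freq k ^ Suc j * cos (freq k * t + real (Suc j) * (pi / 2))) (at t)" for k t
  proof -
    have "cos (freq k * t + real (Suc j) * (pi / 2)) = - sin (freq k * t + real j * (pi / 2))"
      using cos_add[of "freq k * t + real j * (pi / 2)" "pi / 2"]
      by (simp add: algebra_simps add_divide_distrib)
    then show ?thesis
      by (auto intro!: derivative_eq_intros)
  qed
  have "uniformly_convergent_on UNIV
      (\<lambda>n t. \<Sum>k<n. amp k * freq k ^ Suc j * cos (freq k * t + real (Suc j) * (pi / 2)))"
    by (rule Weierstrass_m_test'[OF cos_term_bound sums_summable[OF half_powers_sums]])
  then show "uniformly_convergent_on UNIV
      (\<lambda>n t. \<Sum>k<n. amp k * freq k ^ Suc j * cos (freq k * t + real (Suc j) * (pi / 2)))" .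
  show "summable (\<lambda>k. amp k * freq k ^ j * cos (freq k * 0 + real j * (pi / 2)))"
    by (rule summable_cos_series)
qed auto

text \<open>Amplitudes are positive, so all terms peak together at 0. This keeps the denominator of
  the reciprocal used below away from zero.\<close>

lemma cos_series_le: "cos_series 0 t \<le> cos_series 0 0"
  unfolding cos_series_def
proof (rule suminf_le[OF _ summable_cos_series summable_cos_series])
  show "amp k * freq k ^ 0 * cos (freq k * t + real 0 * (pi / 2))
      \<le> amp k * freq k ^ 0 * cos (freq k * 0 + real 0 * (pi / 2))" for k
    using amp_pos[of k] by simp
qed

lemma cos_series_odd_0:
  assumes "odd j"
  shows "cos_series j 0 = 0"
proof -
  obtain i where "j = 2 * i + 1"
    using assms by (rule oddE)
  then have "real j * (pi / 2) = real i * pi + pi / 2"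
    by (simp add: field_simps)
  then have "cos (real j * (pi / 2)) = 0"
    by (simp only: cos_add cos_pi_half sin_npi)
  then show ?thesis
    by (simp add: cos_series_def)
qed

text \<open>At 0 every term has the sign (-1)^i, so nothing cancels and the term k = 2i alone gives
  the bound.\<close>

lemma cos_series_even_0: "(1/2) ^ Suc (2 * i) * N (2 * i) \<le> (-1) ^ i * cos_series (2 * i) 0"
proof -
  have eq: "amp k * freq k ^ (2 * i) * cos (freq k * 0 + real (2 * i) * (pi / 2))
      = (-1) ^ i * (amp k * freq k ^ (2 * i))" for k
    using cos_npi[of i] by (simp add: mult_ac)
  have sgn: "(-1) ^ i * ((-1) ^ i * x) = x" for x :: real
    by (simp flip: mult.assoc power_add mult_2)
  have summ: "summable (\<lambda>k. (-1) ^ i * ((-1) ^ i * (amp k * freq k ^ (2 * i))))"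
    using summable_cos_series[of "2 * i" 0] unfolding eq by (rule summable_mult)
  have "(1/2) ^ Suc (2 * i) * N (2 * i) = (\<Sum>k\<in>{2 * i}. amp k * freq k ^ (2 * i))"
    using freq_pos[of "2 * i"] by (simp add: amp_def)
  also have "\<dots> \<le> (\<Sum>k. amp k * freq k ^ (2 * i))"
    using summ amp_pos freq_pos unfolding sgn by (intro sum_le_suminf) (auto simp: less_imp_le)
  also have "\<dots> = (-1) ^ i * cos_series (2 * i) 0"
    using suminf_mult[OF summable_cos_series[of "2 * i" 0], of "(-1) ^ i"]
    unfolding cos_series_def eq sgn by simp
  finally show ?thesis .
qed

end

subsection \<open>Holomorphic closedness implies the root condition\<close>

text \<open>Differentiating a Taylor coefficient with respect to the base point t gives the
  coefficient of \<open>fps_deriv\<close>. If coefficient n of the product is constant in t,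
  coefficient n + 1 therefore vanishes; the induction needs the claim for all t.\<close>

lemma taylor_fps_mult_eq_1:
  fixes u v :: "nat \<Rightarrow> real \<Rightarrow> real"
  assumes u: "\<And>k t. (u k has_real_derivative u (Suc k) t) (at t)"
    and v: "\<And>k t. (v k has_real_derivative v (Suc k) t) (at t)"
    and uv: "\<And>t. u 0 t * v 0 t = 1"
  shows "Abs_fps (\<lambda>k. u k t / fact k) * Abs_fps (\<lambda>k. v k t / fact k) = 1"
proof -
  define U where "U t = Abs_fps (\<lambda>k. u k t / fact k)" for t
  define V where "V t = Abs_fps (\<lambda>k. v k t / fact k)" for t
  have U': "((\<lambda>t. U t $ n) has_real_derivative fps_deriv (U t) $ n) (at t)" for n t
    using DERIV_cdivide[OF u[of n t], of "fact n"] by (simp add: U_def)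
  have V': "((\<lambda>t. V t $ n) has_real_derivative fps_deriv (V t) $ n) (at t)" for n t
    using DERIV_cdivide[OF v[of n t], of "fact n"] by (simp add: V_def)
  have W': "((\<lambda>t. (U t * V t) $ n) has_real_derivative fps_deriv (U t * V t) $ n) (at t)" for n t
  proof -
    have "((\<lambda>t. \<Sum>i=0..n. U t $ i * V t $ (n - i)) has_real_derivative
        (\<Sum>i=0..n. fps_deriv (U t) $ i * V t $ (n - i) + fps_deriv (V t) $ (n - i) * U t $ i)) (at t)"
      by (intro DERIV_sum DERIV_mult U' V')
    moreover have "(\<Sum>i=0..n. fps_deriv (U t) $ i * V t $ (n - i) + fps_deriv (V t) $ (n - i) * U t $ i)
        = fps_deriv (U t * V t) $ n"
      unfolding fps_deriv_mult fps_add_nth fps_mult_nth sum.distrib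
      by (subst add.commute, intro arg_cong2[of _ _ _ _ "(+)"] sum.cong refl mult.commute)
    ultimately show ?thesis
      by (simp only: fps_mult_nth)
  qed
  have "(U t * V t) $ n = (1 :: real fps) $ n" for n t
  proof (induction n arbitrary: t)
    case 0
    then show ?case
      using uv by (simp add: U_def V_def)
  next
    case (Suc n)
    have "((\<lambda>t. (1 :: real fps) $ n) has_real_derivative fps_deriv (U t * V t) $ n) (at t)"
      using W'[of n t] unfolding Suc .
    then have "fps_deriv (U t * V t) $ n = 0"
      using DERIV_unique DERIV_const by blast
    then show ?case
      by (simp del: fps_deriv_mult)
  qed
  then show ?thesis
    unfolding U_def V_def by (simp add: fps_eq_iff)
qed

text \<open>Writing \<^term>\<open>V = 1 - G\<close>, the substitution of i x for x makes all coefficients of the even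
  series G nonnegative, so the geometric series 1 / (1 - G) dominates each of its terms.\<close>

lemma fps_inverse_coeff_ge:
  fixes U V :: "real fps"
  assumes UV: "U * V = 1" and V0: "V $ 0 = 1" and V_odd: "\<And>k. odd k \<Longrightarrow> V $ k = 0"
    and V_even: "\<And>i. 1 \<le> i \<Longrightarrow> 0 \<le> - ((-1) ^ i * V $ (2 * i))" and i: "1 \<le> i"
  shows "(- ((-1) ^ i * V $ (2 * i))) ^ n \<le> (-1) ^ (n * i) * U $ (2 * (n * i))"
proof -
  define c where "c i = - ((-1) ^ i * V $ (2 * i))" for i
  \<comment> \<open>After the substitution, \<open>c\<close> (at positive indices) and
    \<open>h\<close> are the even coefficients of G and of 1 / (1 - G). The identity 1 / (1 - G) = 1
    + G / (1 - G) becomes the recursion \<open>h_rec\<close>.\<close>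
  define h where "h m = (-1) ^ m * U $ (2 * m)" for m
  have h0: "h 0 = 1"
    using arg_cong[OF UV, of "\<lambda>F. F $ 0"] V0 by (simp add: h_def)
  have h_rec: "h m = (\<Sum>i\<in>{1..m}. c i * h (m - i))" if m: "1 \<le> m" for m
  proof -
    have "0 = (V * U) $ (2 * m)"
      using UV m by (simp add: mult.commute)
    also have "\<dots> = (\<Sum>i\<le>2 * m. V $ i * U $ (2 * m - i))"
      by (simp add: fps_mult_nth atLeast0AtMost)
    \<comment> \<open>A vanishing odd term is appended to make the number of summands even, so that
      they can be grouped in pairs.\<close>
    also have "\<dots> = (\<Sum>i\<le>Suc (2 * m). V $ i * U $ (2 * m - i))"
      using V_odd[of "Suc (2 * m)"] by simp
    also have "\<dots> = (\<Sum>i\<le>m. V $ (2 * i) * U $ (2 * m - 2 * i) + V $ Suc (2 * i) * U $ (2 * m - Suc (2 * i)))"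
      by (rule sum.in_pairs_0)
    also have "\<dots> = (\<Sum>i\<le>m. V $ (2 * i) * U $ (2 * (m - i)))"
      using V_odd by (simp add: diff_mult_distrib2)
    finally have "0 = (-1) ^ m * (\<Sum>i\<le>m. V $ (2 * i) * U $ (2 * (m - i)))"
      by simp
    also have "\<dots> = (\<Sum>i\<le>m. ((-1) ^ i * V $ (2 * i)) * h (m - i))"
      unfolding sum_distrib_left
    proof (rule sum.cong[OF refl])
      fix i assume "i \<in> {..m}"
      then have "(-1::real) ^ m = (-1) ^ i * (-1) ^ (m - i)"
        by (simp flip: power_add)
      then show "(-1) ^ m * (V $ (2 * i) * U $ (2 * (m - i))) = (-1) ^ i * V $ (2 * i) * h (m - i)"
        by (simp add: h_def mult_ac)
    qed
    also have "\<dots> = h m + (\<Sum>i\<in>{1..m}. ((-1) ^ i * V $ (2 * i)) * h (m - i))"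
      using V0 by (simp add: atMost_atLeast0 sum.atLeast_Suc_atMost)
    finally show ?thesis
      by (simp add: c_def sum_negf)
  qed
  have c_nonneg: "0 \<le> c i" if "1 \<le> i" for i
    unfolding c_def by (rule V_even[OF that])
  have h_nonneg: "0 \<le> h m" for m
  proof (induction m rule: less_induct)
    case (less m)
    show ?case
    proof (cases "m = 0")
      case False
      then have "h m = (\<Sum>i\<in>{1..m}. c i * h (m - i))"
        by (intro h_rec) simp
      also have "\<dots> \<ge> 0"
        using less c_nonneg by (intro sum_nonneg mult_nonneg_nonneg) auto
      finally show ?thesis .
    qed (simp add: h0)
  qed
  have h_ge: "c i * h m \<le> h (i + m)" for m
  proof -
    have "c i * h (i + m - i) \<le> (\<Sum>j\<in>{1..i + m}. c j * h (i + m - j))"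
      by (rule member_le_sum[where f = "\<lambda>j. c j * h (i + m - j)"])
        (use i c_nonneg h_nonneg in \<open>auto intro!: mult_nonneg_nonneg\<close>)
    then show ?thesis
      using h_rec[of "i + m"] i by simp
  qed
  have "c i ^ n \<le> h (n * i)"
  proof (induction n)
    case (Suc n)
    have "c i ^ Suc n \<le> c i * h (n * i)"
      using Suc c_nonneg[OF i] by (simp add: mult_left_mono)
    also have "\<dots> \<le> h (i + n * i)"
      by (rule h_ge)
    finally show ?case
      by simp
  qed (simp add: h0)
  then show ?thesis
    by (simp add: c_def h_def)
qed

section \<open>From the reciprocal of the cosine series to the root condition\<close>

lemma smooth_scalar_one_dim_derivs:
  assumes "smooth_scalar 1 (Rn 1) f"
  defines "u \<equiv> \<lambda>k t. pds (replicate k 0) f (\<lambda>i. if i = 0 then t else 0)"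
  shows "(u k has_real_derivative u (Suc k) t) (at t)"
proof -
  define x where "x t = (\<lambda>i :: nat. if i = 0 then t else 0 :: real)" for t
  have "x t \<in> Rn 1" "set (replicate k 0) \<subseteq> {..<1::nat}"
    by (auto simp: x_def Rn_def)
  then have "(\<lambda>s. pds (replicate k 0) f ((x t)(0 := x t 0 + s))) differentiable (at 0)"
    using assms(1) zero_less_one unfolding smooth_scalar_def by blast
  then have "((\<lambda>s. pds (replicate k 0) f ((x t)(0 := x t 0 + s))) has_real_derivative
      pd 0 (pds (replicate k 0) f) (x t)) (at 0)"
    by (rule has_real_derivative_pd)
  moreover have "(x t)(0 := x t 0 + s) = x (s + t)" for s
    by (auto simp: x_def)
  ultimately have "((\<lambda>s. u k (s + t)) has_real_derivative u (Suc k) t) (at 0)"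
    by (simp add: u_def x_def)
  then show ?thesis
    using DERIV_shift[of "u k" "u (Suc k) t" 0 t] by simp
qed

lemma log_convex_weight:
  assumes "weight_matrix Lam M" "l \<in> Lam"
  shows "log_convex_sequence (\<lambda>k. fact k * M l k)"
proof
  show "(fact (Suc k) * M l (Suc k))\<^sup>2 \<le> fact k * M l k * (fact (Suc (Suc k)) * M l (Suc (Suc k)))" for k
    using weight_matrixD(4)[OF assms, of "Suc k"] by simp
qed (use weight_matrixD(1,2)[OF assms] in auto)

text \<open>The function g contains all N j at once, so membership of a single reciprocal yields one
  m and A for all i and n.\<close>

lemma holo_closed_imp_even_multiples:
  assumes WM: "weight_matrix Lam M" and holo: "holo_closed Lam M" and l: "l \<in> Lam"
  obtains m A where "m \<in> Lam" "A > 0"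
    "\<And>i n. 1 \<le> i \<Longrightarrow> 1 \<le> n \<Longrightarrow> M l (2 * i) ^ n \<le> A ^ (2 * i * n) * M m (2 * i * n)"
proof -
  interpret log_convex_sequence "\<lambda>k. fact k * M l k"
    by (rule log_convex_weight[OF WM l])
  \<comment> \<open>This value normalizes the constant Taylor coefficient of the denominator at 0 to
    1.\<close>
  define R where "R = cos_series 0 0 + 1"
  have R: "R - cos_series 0 t \<ge> 1" for t
    using cos_series_le[of t] by (simp add: R_def)
  define g where "g x j = (if j < 1 then cos_series 0 (x 0) else 0)" for x :: "nat \<Rightarrow> real" and j :: nat
  have "g \<in> EMat Lam M 1 1 {x \<in> Rn 1. x 0 \<in> UNIV}"
  proof (rule EMat_one_dim[where \<phi> = "\<lambda>_. cos_series"])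
    show "\<exists>l\<in>Lam. \<exists>\<rho>>0. \<exists>B\<ge>0. \<forall>t\<in>K. \<forall>k. \<forall>j<1. \<bar>cos_series k t\<bar> \<le> fact k * (B * \<rho> ^ k * M l k)" for K
      using l cos_series_bound by (intro bexI[of _ l] exI[of _ 1] conjI) auto
  qed (use cos_series_deriv weight_matrixD(1)[OF WM] in \<open>auto simp: g_def\<close>)
  then have g: "g \<in> EMat Lam M 1 1 (Rn 1)"
    by simp
  let ?F = "\<lambda>z. 1 / (complex_of_real R - z)"
  let ?h = "\<lambda>x. c2v (?F (complex_of_real (g x 0)))"
  have "?h \<in> EMat Lam M 1 2 (Rn 1)"
  proof -
    have "open_Rn 1 (Rn 1)"
      by (simp add: open_Rn_def)
    moreover have "open (- {complex_of_real R})"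
      by auto
    moreover have "(\<lambda>x. complex_of_real (g x 0)) ` Rn 1 \<subseteq> - {complex_of_real R}"
    proof -
      have "complex_of_real (g x 0) \<in> - {complex_of_real R}" for x
        using R[of "x 0"] by (auto simp: g_def)
      then show ?thesis
        by (rule image_subsetI)
    qed
    moreover have "?F holomorphic_on - {complex_of_real R}"
      by (intro holomorphic_intros) auto
    ultimately show ?thesis
      using holo g unfolding holo_closed_def by blast
  qed
  then have smooth: "smooth_map 1 2 (Rn 1) ?h"
    and EM: "\<And>K. compact K \<Longrightarrow> K \<subseteq> Rn 1 \<Longrightarrow> \<exists>m\<in>Lam. in_EM 1 2 (M m) K ?h"
    by (auto simp: EMat_def)
  have "?h x 0 = 1 / (R - cos_series 0 (x 0))" for x
  proof -
    have "?F (complex_of_real (g x 0)) = complex_of_real (1 / (R - cos_series 0 (x 0)))"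
      by (simp add: g_def)
    then show ?thesis
      unfolding c2v_def by (metis Re_complex_of_real)
  qed
  then have h0: "(\<lambda>x. ?h x 0) = (\<lambda>x. 1 / (R - cos_series 0 (x 0)))"
    by auto
  define u where "u k t = pds (replicate k 0) (\<lambda>x. ?h x 0) (\<lambda>i. if i = 0 then t else 0)" for k t
  have u': "(u k has_real_derivative u (Suc k) t) (at t)" for k t
    unfolding u_def by (rule smooth_scalar_one_dim_derivs) (use smooth in \<open>auto simp: smooth_map_def\<close>)
  define v where "v k t = (if k = 0 then R else 0) - cos_series k t" for k t
  have v': "(v k has_real_derivative v (Suc k) t) (at t)" for k t
    unfolding v_def by (auto intro!: derivative_eq_intros cos_series_deriv)
  have uv: "u 0 t * v 0 t = 1" for t
    using R[of t] by (simp add: u_def v_def h0)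
  \<comment> \<open>Only derivatives at 0 are compared, so the one-point compact set suffices to
    select the weight.\<close>
  obtain m where m: "m \<in> Lam" "in_EM 1 2 (M m) {\<lambda>i. 0} ?h"
    using EM[of "{\<lambda>i. 0}"] by (auto simp: Rn_def)
  obtain \<rho> B where B: "\<rho> > 0" "B > 0" "\<And>x is j. x \<in> {\<lambda>i. 0} \<Longrightarrow> set is \<subseteq> {..<1} \<Longrightarrow> j < 2 \<Longrightarrow>
      \<bar>pds is (\<lambda>y. ?h y j) x\<bar> \<le> fact (length is) * (B * \<rho> ^ length is * M m (length is))"
    using in_EM_imp_pds_bound[OF m(2) weight_matrixD(1)[OF WM m(1)]] by blast
  have u_bound: "\<bar>u k 0\<bar> \<le> fact k * (B * \<rho> ^ k * M m k)" for k
  proof -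
    have "set (replicate k 0) \<subseteq> {..<1::nat}"
      by auto
    then show ?thesis
      using B(3)[of "\<lambda>i. 0" "replicate k 0" 0] by (simp add: u_def cong: if_cong)
  qed
  define c where "c i = (-1) ^ i * cos_series (2 * i) 0 / fact (2 * i)" for i
  have c: "(1/2) ^ Suc (2 * i) * M l (2 * i) \<le> c i" for i
    using cos_series_even_0[of i] by (simp add: c_def field_simps)
  have c_nonneg: "0 \<le> c i" for i
    using c[of i] weight_matrixD(1)[OF WM l, of "2 * i"]
    by (meson less_imp_le mult_nonneg_nonneg order_trans zero_le_power zero_le_divide_1_iff zero_le_numeral)
  let ?U = "Abs_fps (\<lambda>k. u k 0 / fact k)" and ?V = "Abs_fps (\<lambda>k. v k 0 / fact k)"
  have V_even: "- ((-1) ^ i * ?V $ (2 * i)) = c i" if "1 \<le> i" for i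
    using that by (simp add: v_def c_def)
  have main: "c i ^ n \<le> B * \<rho> ^ (2 * i * n) * M m (2 * i * n)" if "1 \<le> i" for i n
  proof -
    have "(- ((-1) ^ i * ?V $ (2 * i))) ^ n \<le> (-1) ^ (n * i) * ?U $ (2 * (n * i))"
    proof (rule fps_inverse_coeff_ge[OF taylor_fps_mult_eq_1[OF u' v' uv]])
      show "?V $ 0 = 1"
        by (simp add: v_def R_def)
      show "?V $ k = 0" if "odd k" for k
        using that cos_series_odd_0[OF that] by (auto simp: v_def)
      show "0 \<le> - ((-1) ^ i * ?V $ (2 * i))" if "1 \<le> i" for i
        unfolding V_even[OF that] by (rule c_nonneg)
    qed (rule that)
    then have "c i ^ n \<le> (-1) ^ (n * i) * ?U $ (2 * (n * i))"
      unfolding V_even[OF that] .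
    also have "\<dots> \<le> \<bar>(-1) ^ (n * i) * ?U $ (2 * (n * i))\<bar>"
      by (rule abs_ge_self)
    also have "\<dots> = \<bar>u (2 * (n * i)) 0\<bar> / fact (2 * (n * i))"
      by (simp add: abs_mult power_abs)
    also have "\<dots> \<le> B * \<rho> ^ (2 * (n * i)) * M m (2 * (n * i))"
      using u_bound[of "2 * (n * i)"] by (simp add: field_simps)
    finally show ?thesis
      by (simp add: mult_ac)
  qed
  show ?thesis
  proof (rule that[OF m(1)])
    \<comment> \<open>With k = 2in, clearing the powers of 1/2 costs 2^((2i+1)n) \<le> 4^k, and B is
      at most (max 1 B)^k because k \<ge> 1.\<close>
    show "4 * \<rho> * max 1 B > 0"
      using B by simp
    fix i n :: nat assume i: "1 \<le> i" and n: "1 \<le> n"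
    let ?k = "2 * i * n"
    have pos_m: "0 < M m ?k"
      using weight_matrixD(1)[OF WM m(1)] .
    have k: "Suc (2 * i) * n \<le> 2 * ?k" "1 \<le> ?k"
      using i n by (auto simp: Suc_le_eq)
    have "M l (2 * i) ^ n = 2 ^ (Suc (2 * i) * n) * ((1/2) ^ Suc (2 * i) * M l (2 * i)) ^ n"
      by (simp add: power_mult_distrib power_mult power_divide del: power_Suc mult_Suc)
    also have "\<dots> \<le> 2 ^ (2 * ?k) * c i ^ n"
    proof (rule mult_mono)
      show "(2::real) ^ (Suc (2 * i) * n) \<le> 2 ^ (2 * ?k)"
        by (rule power_increasing[OF k(1)]) simp
      show "((1/2) ^ Suc (2 * i) * M l (2 * i)) ^ n \<le> c i ^ n"
        using weight_matrixD(1)[OF WM l, of "2 * i"] by (intro power_mono c) auto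
    qed (use weight_matrixD(1)[OF WM l, of "2 * i"] in auto)
    also have "\<dots> \<le> 2 ^ (2 * ?k) * (B * \<rho> ^ ?k * M m ?k)"
      by (intro mult_left_mono main i) auto
    also have "\<dots> = 4 ^ ?k * (\<rho> ^ ?k * (B * M m ?k))"
    proof -
      have "(2::real) ^ (2 * ?k) = 4 ^ ?k"
        by (simp only: power_mult[of _ 2]) simp
      then show ?thesis
        by (simp only: mult_ac)
    qed
    also have "\<dots> \<le> 4 ^ ?k * (\<rho> ^ ?k * (max 1 B ^ ?k * M m ?k))"
    proof (intro mult_left_mono mult_right_mono)
      have "B \<le> max 1 B ^ 1"
        by simp
      also have "\<dots> \<le> max 1 B ^ ?k"
        using k(2) by (intro power_increasing) auto
      finally show "B \<le> max 1 B ^ ?k" .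
    qed (use B pos_m in auto)
    also have "\<dots> = (4 * \<rho> * max 1 B) ^ ?k * M m ?k"
      by (simp add: power_mult_distrib mult_ac)
    finally show "M l (2 * i) ^ n \<le> (4 * \<rho> * max 1 B) ^ ?k * M m ?k" .
  qed
qed

text \<open>For j < k, j is rounded up to an even number 2i and k down to a multiple 2in of it. Each
  rounding changes the index by at most a factor 2 and costs D; A bridges the two rounded
  indices.\<close>

lemma holo_closed_imp_root:
  assumes WM: "weight_matrix Lam M" and holo: "holo_closed Lam M"
  shows "cond_root Lam M"
  unfolding cond_root_def
proof
  fix l assume l: "l \<in> Lam"
  obtain m0 A where m0: "m0 \<in> Lam" "A > 0"
    "\<And>i n. 1 \<le> i \<Longrightarrow> 1 \<le> n \<Longrightarrow> M l (2 * i) ^ n \<le> A ^ (2 * i * n) * M m0 (2 * i * n)"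
    using holo_closed_imp_even_multiples[OF WM holo l] by blast
  define m where "m = max l m0"
  have m: "m \<in> Lam" "l \<le> m" "m0 \<le> m"
    using l m0 by (auto simp: m_def max_def)
  define D where "D = 2 * exp (1::real)"
  have D: "D > 0"
    by (simp add: D_def)
  have double: "root j (M a j) \<le> D * root k (M a k)" if "a \<in> Lam" "1 \<le> j" "j \<le> k" "k \<le> 2 * j" for a j k
    unfolding D_def
    by (rule root_weight_le_of_le_double[OF weight_matrixD(1)[OF WM that(1)] log_convex_weight[OF WM that(1)] that(2-)])
  have nonneg: "0 \<le> root k (M a k)" if "a \<in> Lam" for a k
    using weight_matrixD(1)[OF WM that, of k] by (cases "k = 0") auto
  have mono: "root k (M a k) \<le> root k (M m k)" if "a \<in> Lam" "a \<le> m" for a k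
    using weight_matrixD(3)[OF WM that(1) m(1) that(2), of k] by (cases "k = 0") auto
  have "root j (M l j) \<le> max 1 (D * A * D) * root k (M m k)" if jk: "1 \<le> j" "j \<le> k" for j k
  proof (cases "j = k")
    case True
    have "root j (M l j) \<le> 1 * root k (M m k)"
      using mono[OF l m(2)] True by simp
    also have "\<dots> \<le> max 1 (D * A * D) * root k (M m k)"
      by (intro mult_right_mono nonneg m) auto
    finally show ?thesis .
  next
    case False
    \<comment> \<open>The case j = k is separate because rounding an odd j up stays below or at k
      only for j < k.\<close>
    define i where "i = (j + 1) div 2"
    have i: "1 \<le> i" "j \<le> 2 * i" "2 * i \<le> k" "2 * i \<le> 2 * j"
      using jk False by (auto simp: i_def)
    \<comment> \<open>Here n \<ge> 1, so the remainder is less than 2i \<le> 2in, and rounding down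
      loses less than half of k.\<close>
    define n where "n = k div (2 * i)"
    have n1: "1 \<le> n"
      using i by (simp add: n_def div_greater_zero_iff Suc_le_eq)
    have split: "2 * i * n + k mod (2 * i) = k"
      unfolding n_def by (rule mult_div_mod_eq)
    moreover have "k mod (2 * i) < 2 * i"
      using i by simp
    moreover have "2 * i \<le> 2 * i * n"
      using n1 by simp
    ultimately have n: "2 * i * n \<le> k" "k \<le> 2 * (2 * i * n)" "1 \<le> 2 * i * n"
      using i by linarith+
    have "root j (M l j) \<le> D * root (2 * i) (M l (2 * i))"
      by (rule double) (use l jk i in auto)
    also have "root (2 * i) (M l (2 * i)) \<le> A * root (2 * i * n) (M m0 (2 * i * n))"
    proof -
      have "root (2 * i * n) (M l (2 * i) ^ n) \<le> root (2 * i * n) (A ^ (2 * i * n) * M m0 (2 * i * n))"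
        using m0(3)[OF i(1) n1] n(3) by simp
      moreover have "root (2 * i * n) (M l (2 * i) ^ n) = root (2 * i) (M l (2 * i))"
        using n1 i weight_matrixD(1)[OF WM l, of "2 * i"]
        by (subst real_root_mult_exp) (simp add: real_root_power_cancel less_imp_le)
      moreover have "root (2 * i * n) (A ^ (2 * i * n)) = A"
        using n(3) m0(2) by (intro real_root_power_cancel) auto
      ultimately show ?thesis
        by (simp only: real_root_mult)
    qed
    also have "root (2 * i * n) (M m0 (2 * i * n)) \<le> root (2 * i * n) (M m (2 * i * n))"
      by (rule mono[OF m0(1) m(3)])
    also have "root (2 * i * n) (M m (2 * i * n)) \<le> D * root k (M m k)"
      by (rule double) (use m n in auto)
    finally have "root j (M l j) \<le> D * A * D * root k (M m k)"
      using D m0(2) by (simp add: mult_ac)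
    also have "\<dots> \<le> max 1 (D * A * D) * root k (M m k)"
      by (intro mult_right_mono nonneg m) auto
    finally show ?thesis .
  qed
  moreover have "max 1 (D * A * D) > 0"
    by simp
  ultimately show "\<exists>m\<in>Lam. \<exists>C>0. \<forall>j k. 1 \<le> j \<and> j \<le> k \<longrightarrow> root j (M l j) \<le> C * root k (M m k)"
    using m(1) by blast
qed

theorem theorem4p9:
  fixes Lam :: "real set" and M :: "real \<Rightarrow> nat \<Rightarrow> real"
  assumes "weight_matrix Lam M"
  shows "(cond_dc Lam M \<and> cond_Comega Lam M \<longrightarrow>
            (stable_comp Lam M \<longleftrightarrow> holo_closed Lam M) \<and>
            (holo_closed Lam M \<longleftrightarrow> cond_root Lam M) \<and>
            (cond_root Lam M \<longleftrightarrow> cond_FdB Lam M))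
       \<and> (cond_Comega Lam M \<longrightarrow> stable_comp Lam M \<longrightarrow> holo_closed Lam M)
       \<and> (holo_closed Lam M \<longrightarrow> cond_root Lam M)
       \<and> (cond_dc Lam M \<longrightarrow> cond_root Lam M \<longrightarrow> cond_FdB Lam M)
       \<and> (cond_FdB Lam M \<longrightarrow> stable_comp Lam M)"
  \<comment> \<open>The equivalences come from one cycle: Faa di Bruno condition, composition,
    holomorphic closedness, root condition, and back.\<close>
  using stable_comp_imp_holo_closed[OF assms] holo_closed_imp_root[OF assms]
    root_imp_FdB[OF assms] FdB_imp_stable_comp[OF assms] by blast

end
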